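(* Let $H\in(\frac12,1)$, $x_0\in\mathbb{R}$ deterministic, and let $g:\mathbb{R}^2\to\mathbb{R}$ be bounded and of class $\mathcal{C}^3$ with bounded derivatives of order $1,2,3$. Let $T\in(0,\infty)$, and let the time-step size $\Delta t$ satisfy $T=N\Delta t$ with $N\in\mathbb{N}$. Let $(X_n^0)_{n\ge 0}$ be given by the limiting scheme $$X_{n+1}^0=X_n^0+g(X_n^0,\gamma_n)\bigl(\beta^H(t_{n+1})-\beta^H(t_n)\bigr),$$ and let $(\overline{X}_n)_{n\ge 0}$ be given by the auxiliary scheme $$\overline{X}_{n+1}=\overline{X}_n+\overline{g}(\overline{X}_n)\bigl(\beta^H(t_{n+1})-\beta^H(t_n)\bigr),$$ with $X_0^0=\overline{X}_0=x_0$. Then for any mapping $\varphi:\mathbb{R}\to\mathbb{R}$ of class $\mathcal{C}_b^3$, one has $$\lim_{\Delta t\to 0}\mathbb{E}\Bigl[\bigl|\mathbb{E}[\varphi(X_N^0)\,|\,\mathcal{F}^H]-\varphi(\overline{X}_N)\bigr|\Bigr]=0.$$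
   Context: $(\beta^H(t))_{t\ge 0}$ is a real-valued fractional Brownian motion with Hurst index $H\in(\frac12,1)$, $(B(t))_{t\ge 0}$ is a standard real-valued Brownian motion independent of $\beta^H$, and $\mathcal{F}^H=\sigma\{\beta^H(t);\,t\ge 0\}$. For a time-step size $\Delta t$, set $t_n=n\Delta t$ and $\gamma_n=\Delta t^{-1/2}(B(t_{n+1})-B(t_n))$ for $n\ge 0$ (so the $\gamma_n$ are independent standard Gaussian random variables, independent of $\beta^H$). The averaged coefficient is $\overline{g}(x)=\int g(x,m)\,d\nu(m)$, with $\nu=\mathcal{N}(0,1)$ the standard Gaussian distribution. A mapping $\varphi:\mathbb{R}\to\mathbb{R}$ is of class $\mathcal{C}_b^K$ if it is bounded and $K$ times continuously differentiable with bounded derivatives of order $1,\ldots,K$. The limit $\Delta t\to0$ is along $\Delta t=T/N$, $N\to\infty$, with $T$ fixed. *)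

theory Defs
  imports "HOL-Probability.Probability"
begin

text \<open>Bounded functions that are \<open>k\<close> times continuously differentiable with bounded partial
  derivatives of orders \<open>1, \<dots>, k\<close>.  The continuity of the derivatives of order below \<open>k\<close> is
  implied by their differentiability.\<close>

primrec Cb :: "nat \<Rightarrow> ('a::euclidean_space \<Rightarrow> real) \<Rightarrow> bool" where
  "Cb 0 f \<longleftrightarrow> bounded (range f) \<and> continuous_on UNIV f"
| "Cb (Suc k) f \<longleftrightarrow> bounded (range f) \<and> (\<forall>x. f differentiable (at x)) \<and>
     (\<forall>b\<in>Basis. Cb k (\<lambda>x. frechet_derivative f (at x) b))"

lemma Cb_Suc_real:
  fixes f :: "real \<Rightarrow> real"
  shows "Cb (Suc k) f \<longleftrightarrow>
    bounded (range f) \<and> (\<forall>x. f field_differentiable (at x)) \<and> Cb k (deriv f)"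
proof -
  have "(\<lambda>x. frechet_derivative f (at x) 1) = deriv f"
    if "\<forall>x. f field_differentiable (at x)"
  proof
    fix x
    have "(f has_derivative (*) (deriv f x)) (at x)"
      using that DERIV_deriv_iff_field_differentiable has_field_derivative_def by blast
    then show "frechet_derivative f (at x) 1 = deriv f x"
      by (metis frechet_derivative_at mult.right_neutral)
  qed
  moreover have "f differentiable (at x) \<longleftrightarrow> f field_differentiable (at x)" for x
    by (simp add: field_differentiable_def real_differentiable_def)
  ultimately show ?thesis
    by auto
qed

lemma Cb_Suc_pair:
  fixes f :: "real \<times> real \<Rightarrow> real"
  shows "Cb (Suc k) f \<longleftrightarrow> bounded (range f) \<and> (\<forall>x. f differentiable (at x)) \<and>
    Cb k (\<lambda>x. frechet_derivative f (at x) (1, 0)) \<and>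
    Cb k (\<lambda>x. frechet_derivative f (at x) (0, 1))"
  by (auto simp: Basis_prod_def)

text \<open>Real-valued processes \<open>Z t \<omega>\<close> are indexed by \<open>real\<close>, but only the times \<open>t \<ge> 0\<close> matter.\<close>

definition process_sigma :: "'a measure \<Rightarrow> (real \<Rightarrow> 'a \<Rightarrow> real) \<Rightarrow> 'a measure" where
  "process_sigma M Z =
     sigma (space M) {Z t -` A \<inter> space M | t A. 0 \<le> t \<and> A \<in> sets borel}"

definition indep_processes ::
  "'a measure \<Rightarrow> (real \<Rightarrow> 'a \<Rightarrow> real) \<Rightarrow> (real \<Rightarrow> 'a \<Rightarrow> real) \<Rightarrow> bool" where
  "indep_processes M Y Z \<longleftrightarrow>
     prob_space.indep_set M (sets (process_sigma M Y)) (sets (process_sigma M Z))"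

text \<open>Constants count as (degenerate) Gaussian random variables.\<close>

definition gaussian_rv :: "'a measure \<Rightarrow> ('a \<Rightarrow> real) \<Rightarrow> bool" where
  "gaussian_rv M X \<longleftrightarrow> X \<in> borel_measurable M \<and>
     (\<exists>\<mu>. (AE \<omega> in M. X \<omega> = \<mu>) \<or>
          (\<exists>\<sigma>>0. distributed M lborel X (normal_density \<mu> \<sigma>)))"

definition gaussian_process :: "'a measure \<Rightarrow> (real \<Rightarrow> 'a \<Rightarrow> real) \<Rightarrow> bool" where
  "gaussian_process M Z \<longleftrightarrow>
     (\<forall>J c. finite J \<longrightarrow> J \<subseteq> {0..} \<longrightarrow> gaussian_rv M (\<lambda>\<omega>. \<Sum>t\<in>J. c t * Z t \<omega>))"

definition fractional_brownian_motion ::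
  "'a measure \<Rightarrow> real \<Rightarrow> (real \<Rightarrow> 'a \<Rightarrow> real) \<Rightarrow> bool" where
  "fractional_brownian_motion M H Z \<longleftrightarrow>
     gaussian_process M Z \<and>
     (\<forall>t\<ge>0. (LINT \<omega>|M. Z t \<omega>) = 0) \<and>
     (\<forall>s\<ge>0. \<forall>t\<ge>0. (LINT \<omega>|M. Z s \<omega> * Z t \<omega>) =
        (s powr (2 * H) + t powr (2 * H) - \<bar>t - s\<bar> powr (2 * H)) / 2) \<and>
     (AE \<omega> in M. continuous_on {0..} (\<lambda>t. Z t \<omega>))"

definition brownian_motion :: "'a measure \<Rightarrow> (real \<Rightarrow> 'a \<Rightarrow> real) \<Rightarrow> bool" where
  "brownian_motion M B \<longleftrightarrow>
     (\<forall>t\<ge>0. B t \<in> borel_measurable M) \<and>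
     (AE \<omega> in M. B 0 \<omega> = 0) \<and>
     (\<forall>(\<tau> :: nat \<Rightarrow> real) n. 0 \<le> \<tau> 0 \<longrightarrow> (\<forall>i<n. \<tau> i \<le> \<tau> (Suc i)) \<longrightarrow>
        prob_space.indep_vars M (\<lambda>_. borel) (\<lambda>i \<omega>. B (\<tau> (Suc i)) \<omega> - B (\<tau> i) \<omega>) {..<n}) \<and>
     (\<forall>s t. 0 \<le> s \<longrightarrow> s < t \<longrightarrow>
        distributed M lborel (\<lambda>\<omega>. B t \<omega> - B s \<omega>) (normal_density 0 (sqrt (t - s)))) \<and>
     (AE \<omega> in M. continuous_on {0..} (\<lambda>t. B t \<omega>))"

definition averaged :: "(real \<times> real \<Rightarrow> real) \<Rightarrow> real \<Rightarrow> real" where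
  "averaged g x = (LINT m|density lborel std_normal_density. g (x, m))"

definition scaled_increment :: "(real \<Rightarrow> 'a \<Rightarrow> real) \<Rightarrow> real \<Rightarrow> nat \<Rightarrow> 'a \<Rightarrow> real" where
  "scaled_increment B dt n \<omega> =
     dt powr (- 1 / 2) * (B (real (Suc n) * dt) \<omega> - B (real n * dt) \<omega>)"

primrec limiting_scheme ::
  "(real \<times> real \<Rightarrow> real) \<Rightarrow> real \<Rightarrow> (real \<Rightarrow> 'a \<Rightarrow> real) \<Rightarrow> (real \<Rightarrow> 'a \<Rightarrow> real) \<Rightarrow> real \<Rightarrow>
    nat \<Rightarrow> 'a \<Rightarrow> real" where
  "limiting_scheme g x0 \<beta> B dt 0 = (\<lambda>\<omega>. x0)"
| "limiting_scheme g x0 \<beta> B dt (Suc n) = (\<lambda>\<omega>.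
     limiting_scheme g x0 \<beta> B dt n \<omega> +
     g (limiting_scheme g x0 \<beta> B dt n \<omega>, scaled_increment B dt n \<omega>) *
       (\<beta> (real (Suc n) * dt) \<omega> - \<beta> (real n * dt) \<omega>))"

primrec auxiliary_scheme ::
  "(real \<times> real \<Rightarrow> real) \<Rightarrow> real \<Rightarrow> (real \<Rightarrow> 'a \<Rightarrow> real) \<Rightarrow> real \<Rightarrow> nat \<Rightarrow> 'a \<Rightarrow> real" where
  "auxiliary_scheme g x0 \<beta> dt 0 = (\<lambda>\<omega>. x0)"
| "auxiliary_scheme g x0 \<beta> dt (Suc n) = (\<lambda>\<omega>.
     auxiliary_scheme g x0 \<beta> dt n \<omega> +
     averaged g (auxiliary_scheme g x0 \<beta> dt n \<omega>) *
       (\<beta> (real (Suc n) * dt) \<omega> - \<beta> (real n * dt) \<omega>))"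

end

theory Submission
  imports Defs
begin

text \<open>In dimension one the averaged equation driven by \<open>\<beta>\<close> is solved by the flow \<open>\<Phi>\<close> of
  \<open>x' = f(x)\<close>, where \<open>f\<close> is the averaged coefficient, run for the time \<open>\<beta>(T) - \<beta>(t)\<close>. Put
  \<open>v(s, x) = \<phi>(\<Phi>(s, x))\<close> and \<open>s\<^sub>n = \<beta>(T) - \<beta>(t\<^sub>n)\<close>. Along either scheme, \<open>v(s\<^sub>n, X\<^sub>n)\<close> changes in
  one step by a term linear in the fluctuation of the coefficient around \<open>f\<close>, plus \<open>O(b\<^sub>n\<^sup>2)\<close> where
  \<open>b\<^sub>n\<close> is the increment of \<open>\<beta>\<close>. The constant depends only on a bound \<open>S\<close> for the \<open>\<bar>s\<^sub>n\<bar>\<close>, not on the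
  total variation of the discretised path, which diverges. The linear term is centred
  since \<open>\<gamma>\<^sub>n\<close> is independent of \<open>\<beta>\<close> and \<open>X\<^sub>n\<close>, and
  \<open>\<Sum> E b\<^sub>n\<^sup>2 = N (T/N)\<^sup>2\<^sup>H\<close> tends to \<open>0\<close> because \<open>H > 1/2\<close>.

  The conditional expectation is removed by testing against the \<open>\<beta>\<close>-measurable sign of
  \<open>E[\<phi>(X\<^sub>N) | \<beta>] - \<phi>(\<^bold>X\<^sub>N)\<close>, with \<open>\<^bold>X\<close> the auxiliary scheme. The bound \<open>S\<close> is enforced
  by restricting to an event whose probability tends to \<open>1\<close> as \<open>S \<rightarrow> \<infinity>\<close>, uniformly in \<open>N\<close>.\<close>

subsection \<open>Flow of a scalar vector field\<close>

text \<open>Comparing \<open>D\<close> with the monomial \<open>c * s ^ Suc k / real (Suc k)\<close>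
  by monotonicity turns a bound on the derivative into one on the function. The case
  \<open>k = 0\<close> serves for Lipschitz bounds, \<open>k = 1\<close> for Taylor remainders,
  general \<open>k\<close> for the Picard iterates.\<close>

lemma abs_le_power_of_deriv:
  fixes D D' :: "real \<Rightarrow> real"
  assumes der: "\<And>s. (D has_real_derivative D' s) (at s)" and "D 0 = 0"
    and bnd: "\<And>s. \<bar>s\<bar> \<le> \<bar>t\<bar> \<Longrightarrow> \<bar>D' s\<bar> \<le> c * \<bar>s\<bar> ^ k"
  shows "\<bar>D t\<bar> \<le> c * \<bar>t\<bar> ^ Suc k / real (Suc k)"
proof -
  \<comment> \<open>Stated for arbitrary \<open>E\<close> so that it applies both to
    \<open>D\<close> and to its reflection at 0; the signs 1 and -1 for \<open>\<sigma>\<close> give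
    the two halves of the absolute value.\<close>
  have pos: "\<sigma> * E u \<le> c * u ^ Suc k / real (Suc k)"
    if "0 \<le> u" and E: "\<And>s. (E has_real_derivative E' s) (at s)" "E 0 = 0"
      and b: "\<And>s. 0 \<le> s \<Longrightarrow> s \<le> u \<Longrightarrow> \<bar>E' s\<bar> \<le> c * s ^ k" and \<sigma>: "\<bar>\<sigma>\<bar> = 1"
    for E E' :: "real \<Rightarrow> real" and u \<sigma>
  proof -
    let ?h = "\<lambda>s. c * s ^ Suc k / real (Suc k) - \<sigma> * E s"
    have "?h 0 \<le> ?h u"
    proof (rule DERIV_nonneg_imp_nondecreasing[OF \<open>0 \<le> u\<close>])
      fix s assume s: "0 \<le> s" "s \<le> u"
      have "(?h has_real_derivative c * s ^ k - \<sigma> * E' s) (at s)"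
        by (rule derivative_eq_intros E refl | simp add: field_simps del: of_nat_Suc)+
      moreover have "\<sigma> * E' s \<le> \<bar>\<sigma> * E' s\<bar>" by simp
      then have "0 \<le> c * s ^ k - \<sigma> * E' s"
        using b[OF s] \<sigma> by (simp add: abs_mult)
      ultimately show "\<exists>y. (?h has_real_derivative y) (at s) \<and> 0 \<le> y" by blast
    qed
    then show ?thesis using E by simp
  qed
  show ?thesis
  proof (cases "0 \<le> t")
    case True
    have "\<sigma> * D t \<le> c * t ^ Suc k / real (Suc k)" if "\<bar>\<sigma>\<bar> = 1" for \<sigma>
      using bnd True by (intro pos[OF True der assms(2) _ that]) (metis abs_of_nonneg)
    from this[of 1] this[of "-1"] True show ?thesis by (simp add: abs_le_iff)
  next
    case False
    have der': "((\<lambda>s. D (- s)) has_real_derivative - D' (- s)) (at s)" for s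
      using DERIV_mirror[of D "D' (- s)" s] der[of "- s"] by simp
    have "\<sigma> * D (- (- t)) \<le> c * (- t) ^ Suc k / real (Suc k)" if "\<bar>\<sigma>\<bar> = 1" for \<sigma>
    proof (rule pos[OF _ der' _ _ that])
      show "\<bar>- D' (- s)\<bar> \<le> c * s ^ k" if "0 \<le> s" "s \<le> - t" for s
        using bnd[of "- s"] that by simp
    qed (use False assms(2) in auto)
    from this[of 1] this[of "-1"] False show ?thesis by (simp add: abs_le_iff)
  qed
qed

text \<open>As a function of the displacement \<open>s\<close>, the remainder vanishes at 0 and has
  derivative \<open>f1 (x + s) - f1 x\<close>, which is at most \<open>C * \<bar>s\<bar>\<close> in
  absolute value.\<close>

lemma first_order_taylor_lipschitz:
  fixes f f1 :: "real \<Rightarrow> real"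
  assumes der: "\<And>x. (f has_real_derivative f1 x) (at x)"
    and lip: "\<And>x y. \<bar>f1 x - f1 y\<bar> \<le> C * \<bar>x - y\<bar>"
  shows "\<bar>f y - f x - f1 x * (y - x)\<bar> \<le> C / 2 * (y - x)\<^sup>2"
proof -
  have "((\<lambda>s. f (x + s) - f x - f1 x * s) has_real_derivative f1 (x + s) - f1 x) (at s)" for s
    using der[of "s + x"]
    by (auto intro!: derivative_eq_intros simp: DERIV_shift add.commute)
  from abs_le_power_of_deriv[OF this, of "y - x" C 1] lip[of _ x]
  have "\<bar>f (x + (y - x)) - f x - f1 x * (y - x)\<bar> \<le> C * \<bar>y - x\<bar> ^ 2 / 2"
    by (metis (no_types, opaque_lifting) Suc_1 add_diff_cancel_left' add.right_neutral diff_self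
        mult_zero_right of_nat_numeral power_one_right)
  then show ?thesis by simp
qed

lemma lipschitz_of_bounded_deriv:
  fixes f f1 :: "real \<Rightarrow> real"
  assumes der: "\<And>x. (f has_real_derivative f1 x) (at x)" and "\<And>x. \<bar>f1 x\<bar> \<le> C"
  shows "\<bar>f x - f y\<bar> \<le> C * \<bar>x - y\<bar>"
proof -
  have "((\<lambda>s. f (y + s) - f y) has_real_derivative f1 (y + s)) (at s)" for s
    using der[of "s + y"]
    by (auto intro!: derivative_eq_intros simp: DERIV_shift add.commute)
  from abs_le_power_of_deriv[OF this, of "x - y" C 0] assms(2)
  show ?thesis by simp
qed

section \<open>Global solutions of a scalar differential equation\<close>

lemma antiderivative_real:
  fixes h :: "real \<Rightarrow> real"
  assumes "continuous_on UNIV h"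
  shows "\<exists>F. F 0 = x \<and> (\<forall>t. (F has_real_derivative h t) (at t))"
proof -
  have "\<exists>F. \<forall>t. - \<infinity> < ereal t \<longrightarrow> ereal t < \<infinity> \<longrightarrow> (F has_vector_derivative h t) (at t)"
    by (rule einterval_antiderivative)
      (use assms in \<open>auto simp: continuous_on_eq_continuous_at\<close>)
  then obtain F where F: "\<And>t. (F has_real_derivative h t) (at t)"
    by (auto simp: has_real_derivative_iff_has_vector_derivative)
  have "((\<lambda>t. F t - F 0 + x) has_real_derivative h t) (at t)" for t
    using F by (auto intro!: derivative_eq_intros)
  then show ?thesis by (intro exI[of _ "\<lambda>t. F t - F 0 + x"]) simp
qed

text \<open>Consecutive Picard iterates differ by at most
  \<open>G * L ^ n * \<bar>t\<bar> ^ Suc n / fact (Suc n)\<close>, summable uniformly on bounded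
  intervals. The iteration thus converges on the whole line at once, with no gluing of local
  solutions.\<close>

lemma picard_solution:
  fixes f :: "real \<Rightarrow> real"
  assumes lip: "\<And>x y. \<bar>f x - f y\<bar> \<le> L * \<bar>x - y\<bar>" and bnd: "\<And>x. \<bar>f x\<bar> \<le> G"
  shows "\<exists>y. y 0 = x \<and> (\<forall>t. (y has_real_derivative f (y t)) (at t))"
proof -
  have L0: "0 \<le> L" using lip[of 0 1] by simp
  have "L-lipschitz_on UNIV f"
    using L0 lip by (auto simp: lipschitz_on_def dist_real_def)
  then have fcont: "continuous_on UNIV f"
    by (rule lipschitz_on_continuous_on)
  \<comment> \<open>Continuity stays inside the statement so that choice yields an operator
    \<open>P\<close> on all functions; the iterates can then be defined by recursion before their
    continuity is known.\<close>
  have "\<forall>h. \<exists>F. continuous_on UNIV h \<longrightarrow> F 0 = x \<and> (\<forall>t. (F has_real_derivative h t) (at t))"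
    using antiderivative_real[of _ x] by blast
  then obtain P where P: "\<And>h. continuous_on UNIV h \<Longrightarrow> P h 0 = x"
    "\<And>h t. continuous_on UNIV h \<Longrightarrow> (P h has_real_derivative h t) (at t)"
    by metis
  define y where "y = rec_nat (\<lambda>_. x) (\<lambda>_ z. P (\<lambda>t. f (z t)))"
  have y0: "y 0 = (\<lambda>_. x)" and ySuc: "y (Suc n) = P (\<lambda>t. f (y n t))" for n
    by (simp_all add: y_def)
  have ycont: "continuous_on UNIV (y n)" for n
  proof (induction n)
    case (Suc n)
    have "continuous_on UNIV (\<lambda>t. f (y n t))"
      using continuous_on_compose2[OF fcont Suc] by simp
    then show ?case
      unfolding ySuc by (intro DERIV_continuous_on) (use P in blast)
  qed (simp add: y0)
  have fycont: "continuous_on UNIV (\<lambda>t. f (y n t))" for n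
    using continuous_on_compose2[OF fcont ycont] by simp
  have yder: "(y (Suc n) has_real_derivative f (y n t)) (at t)" for n t
    unfolding ySuc using P(2) fycont by blast
  have yz: "y n 0 = x" for n
    by (cases n) (simp_all add: y0 ySuc P(1)[OF fycont])
  \<comment> \<open>\<open>d'\<close> is the derivative of the increment \<open>d\<close>; at
    \<open>n = 0\<close> nothing is subtracted because \<open>y 0\<close> is constant.\<close>
  define d d' where "d n t = y (Suc n) t - y n t"
    and "d' n t = f (y n t) - (case n of 0 \<Rightarrow> 0 | Suc m \<Rightarrow> f (y m t))" for n t
  have dder: "(d n has_real_derivative d' n t) (at t)" for n t
  proof (cases n)
    case 0
    then show ?thesis
      using yder[of 0 t] by (auto simp: d_def[abs_def] d'_def y0 intro!: derivative_eq_intros)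
  next
    case (Suc m)
    then show ?thesis
      using yder[of n t] yder[of m t]
      by (auto simp: d_def[abs_def] d'_def intro!: derivative_eq_intros)
  qed
  have dbnd: "\<bar>d n t\<bar> \<le> G * L ^ n * \<bar>t\<bar> ^ Suc n / fact (Suc n)" for n t
  proof (induction n arbitrary: t)
    case 0
    show ?case
      using abs_le_power_of_deriv[OF dder, of 0 t G 0] bnd by (simp add: d_def yz d'_def)
  next
    case (Suc n)
    have "\<bar>d' (Suc n) s\<bar> \<le> (G * L ^ Suc n / fact (Suc n)) * \<bar>s\<bar> ^ Suc n" for s
    proof -
      have "\<bar>d' (Suc n) s\<bar> \<le> L * \<bar>d n s\<bar>"
        using lip by (simp add: d'_def d_def)
      also have "\<dots> \<le> L * (G * L ^ n * \<bar>s\<bar> ^ Suc n / fact (Suc n))"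
        using Suc L0 by (intro mult_left_mono)
      finally show ?thesis by (simp add: mult_ac)
    qed
    from abs_le_power_of_deriv[OF dder _ this, of t] show ?case
      by (simp add: d_def yz mult_ac del: power_Suc of_nat_Suc)
  qed
  have sum_d: "(\<Sum>i<n. d i t) = y n t - x" for n t
    using sum_lessThan_telescope[of "\<lambda>i. y i t" n] by (simp add: d_def y0)
  have sum_d': "(\<Sum>i<Suc n. d' i t) = f (y n t)" for n t
    by (induction n) (simp_all add: d'_def)
  have G0: "0 \<le> G" using bnd[of 0] by simp
  have conv: "\<exists>z. uniform_limit {-R..R} y z sequentially" if "0 \<le> R" for R
  proof -
    have "uniform_limit {-R..R} (\<lambda>n t. \<Sum>i<n. d i t) (\<lambda>t. suminf (\<lambda>i. d i t)) sequentially"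
    proof (rule Weierstrass_m_test)
      show "norm (d n t) \<le> G * R * (inverse (fact n) * (L * R) ^ n)" if "t \<in> {-R..R}" for n t
      proof -
        have "norm (d n t) \<le> G * L ^ n * \<bar>t\<bar> ^ Suc n / fact (Suc n)"
          using dbnd by simp
        also have "\<dots> \<le> G * L ^ n * R ^ Suc n / fact n"
          using that L0 G0 \<open>0 \<le> R\<close>
          by (intro frac_le mult_left_mono power_mono fact_mono mult_nonneg_nonneg) auto
        finally show ?thesis by (simp add: field_simps power_mult_distrib)
      qed
      show "summable (\<lambda>n. G * R * (inverse (fact n) * (L * R) ^ n))"
        by (intro summable_mult summable_exp)
    qed
    then have "uniform_limit {-R..R} y (\<lambda>t. suminf (\<lambda>i. d i t) + x) sequentially"
      using uniform_limit_add[OF _ uniform_limit_const[where c = "\<lambda>_. x"]]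
      by (force simp: sum_d)
    then show ?thesis by blast
  qed
  \<comment> \<open>The pointwise limit is one function for all \<open>R\<close>; each uniform limit
    on \<open>{-R..R}\<close> coincides with it there.\<close>
  define z where "z t = lim (\<lambda>n. y n t)" for t
  have ulim: "uniform_limit {-R..R} y z sequentially" if "0 \<le> R" for R
  proof -
    from conv[OF that] obtain z' where z': "uniform_limit {-R..R} y z' sequentially" by blast
    have "z' t = z t" if "t \<in> {-R..R}" for t
      using tendsto_uniform_limitI[OF z' that] limI unfolding z_def by metis
    with z' show ?thesis
      using uniform_limit_cong'[of "{-R..R}" y y z' z sequentially] by auto
  qed
  have zlim: "(\<lambda>n. y n t) \<longlonglongrightarrow> z t" for t
    using tendsto_uniform_limitI[OF ulim[of "\<bar>t\<bar>"], of t] by (simp add: abs_ge_minus_self abs_le_D2 minus_le_iff)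
  have "(z has_real_derivative f (z t)) (at t)" for t
  proof -
    \<comment> \<open>The margin 1 makes \<open>t\<close> an interior point, so a derivative within
      the interval is a full derivative at \<open>t\<close>.\<close>
    let ?R = "\<bar>t\<bar> + 1"
    have uf: "uniform_limit {-?R..?R} (\<lambda>n s. f (y n s)) (\<lambda>s. f (z s)) sequentially"
      by (rule uniform_limit_compose_uniformly_continuous_on
            [OF ulim lipschitz_on_uniformly_continuous[OF \<open>L-lipschitz_on UNIV f\<close>]]) auto
    \<comment> \<open>The derivatives \<open>f (y n s)\<close> of the iterates
      \<open>y (Suc n)\<close> converge uniformly, so the limit may be differentiated
      termwise.\<close>
    have "\<exists>g. \<forall>s\<in>{-?R..?R}. (\<lambda>n. y (Suc n) s) \<longlonglongrightarrow> g s \<and>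
        (g has_derivative (\<lambda>h. f (z s) * h)) (at s within {-?R..?R})"
    proof (rule has_derivative_sequence)
      show "(y (Suc n) has_derivative (\<lambda>h. f (y n s) * h)) (at s within {-?R..?R})" for n s
        using yder[of n s, THEN has_field_derivative_at_within]
        by (simp add: has_field_derivative_def)
      show "\<forall>\<^sub>F n in sequentially. \<forall>s\<in>{-?R..?R}. \<forall>h. norm (f (y n s) * h - f (z s) * h) \<le> e * norm h"
        if "0 < e" for e
        using uniform_limitD[OF uf that]
        by eventually_elim
          (auto simp: dist_real_def left_diff_distrib[symmetric] abs_mult intro!: mult_right_mono
            dest!: bspec)
      show "(\<lambda>n. y (Suc n) 0) \<longlonglongrightarrow> z 0"
        using zlim LIMSEQ_Suc by blast
    qed auto
    then obtain g where g: "\<And>s. s \<in> {-?R..?R} \<Longrightarrow> (\<lambda>n. y (Suc n) s) \<longlonglongrightarrow> g s"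
      "\<And>s. s \<in> {-?R..?R} \<Longrightarrow> (g has_derivative (\<lambda>h. f (z s) * h)) (at s within {-?R..?R})"
      by blast
    have geq: "g s = z s" if "s \<in> {-?R..?R}" for s
      using LIMSEQ_unique[OF g(1)[OF that] LIMSEQ_Suc[OF zlim]] .
    have t: "t \<in> {-?R<..<?R}" by auto
    have "(g has_real_derivative f (z t)) (at t)"
      using g(2)[of t] t at_within_interior[of t "{-?R..?R}"]
      by (simp add: has_field_derivative_def interior_atLeastAtMost_real)
    then show ?thesis
      by (rule has_field_derivative_transform_within_open[where S = "{-?R<..<?R}"])
        (use t geq in auto)
  qed
  moreover have "z 0 = x"
    using LIMSEQ_unique[OF zlim[of 0]] by (simp add: yz)
  ultimately show ?thesis by blast
qed

section \<open>The flow of a bounded field, its Jacobian and Taylor bounds\<close>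

locale scalar_field =
  fixes f f1 :: "real \<Rightarrow> real" and G L L2 :: real
  assumes f_deriv: "\<And>x. (f has_real_derivative f1 x) (at x)"
    and f_bound: "\<And>x. \<bar>f x\<bar> \<le> G"
    and f1_bound: "\<And>x. \<bar>f1 x\<bar> \<le> L"
    and f1_lipschitz: "\<And>x y. \<bar>f1 x - f1 y\<bar> \<le> L2 * \<bar>x - y\<bar>"
begin

lemma nonneg: "0 \<le> G" "0 \<le> L" "0 \<le> L2"
  using f_bound[of 0] f1_bound[of 0] f1_lipschitz[of 0 1] by auto

lemma f_lipschitz: "\<bar>f x - f y\<bar> \<le> L * \<bar>x - y\<bar>"
  using lipschitz_of_bounded_deriv[OF f_deriv f1_bound] .

text \<open>A solution is chosen separately for each starting point; regularity in \<open>x\<close>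
  comes from the Gronwall bound \<open>flow_lipschitz_space\<close>.\<close>

definition flow :: "real \<Rightarrow> real \<Rightarrow> real" where
  "flow s x = (SOME y. y 0 = x \<and> (\<forall>t. (y has_real_derivative f (y t)) (at t))) s"

lemma flow_0: "flow 0 x = x"
  and flow_deriv: "((\<lambda>s. flow s x) has_real_derivative f (flow s x)) (at s)"
  using someI_ex[OF picard_solution[OF f_lipschitz f_bound], of x]
  unfolding flow_def by blast+

lemma flow_lipschitz_time: "\<bar>flow (s + b) x - flow s x\<bar> \<le> G * \<bar>b\<bar>"
  using lipschitz_of_bounded_deriv[OF flow_deriv f_bound, of "s + b" x s] by simp

text \<open>Along an orbit the velocity \<open>f (flow s x)\<close> is Lipschitz in time with
  constant \<open>L * G\<close>, so the Taylor bound applies to the orbit itself.\<close>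

lemma flow_taylor_time: "\<bar>flow (s + b) x - flow s x - b * f (flow s x)\<bar> \<le> L * G / 2 * b\<^sup>2"
proof -
  have "\<bar>f (flow r x) - f (flow t x)\<bar> \<le> L * G * \<bar>r - t\<bar>" for r t
    using order_trans[OF f_lipschitz mult_left_mono[OF flow_lipschitz_time[of t "r - t" x]]]
      nonneg by (simp add: mult_ac)
  from first_order_taylor_lipschitz[OF flow_deriv this, of "s + b" s]
  show ?thesis by (simp add: mult_ac)
qed

text \<open>Gronwall's argument for the squared distance of two orbits, which unlike the distance is
  differentiable everywhere. Multiplied by \<open>exp (- 2 * L * s)\<close> it decreases forward in
  time; multiplied by \<open>exp (2 * L * s)\<close> it increases on the negative half-line.\<close>

lemma flow_lipschitz_space: "\<bar>flow s y - flow s x\<bar> \<le> exp (L * \<bar>s\<bar>) * \<bar>y - x\<bar>"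
proof -
  define D D' where "D s = flow s y - flow s x" and "D' s = f (flow s y) - f (flow s x)" for s
  have der: "(D has_real_derivative D' s) (at s)" for s
    unfolding D_def[abs_def] D'_def by (intro derivative_intros flow_deriv)
  have DD': "\<bar>D s * D' s\<bar> \<le> L * (D s)\<^sup>2" for s
  proof -
    have "\<bar>D s\<bar> * \<bar>D' s\<bar> \<le> \<bar>D s\<bar> * (L * \<bar>D s\<bar>)"
      using f_lipschitz by (intro mult_left_mono) (auto simp: D_def D'_def)
    then show ?thesis by (simp add: abs_mult power2_eq_square mult_ac)
  qed
  have Ider: "((\<lambda>s. (D s)\<^sup>2 * exp (c * s)) has_real_derivative
      (2 * (D s * D' s) + c * (D s)\<^sup>2) * exp (c * s)) (at s)" for s c
    by (rule derivative_eq_intros der refl | simp add: algebra_simps)+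
  have "(D s)\<^sup>2 * exp (- (2 * L * \<bar>s\<bar>)) \<le> (D 0)\<^sup>2"
  proof (cases "0 \<le> s")
    case True
    have "(D s)\<^sup>2 * exp (- 2 * L * s) \<le> (D 0)\<^sup>2 * exp (- 2 * L * 0)"
    proof (rule DERIV_nonpos_imp_nonincreasing[OF True])
      fix u
      have "(2 * (D u * D' u) + (- 2 * L) * (D u)\<^sup>2) * exp (- 2 * L * u) \<le> 0"
        using DD'[of u] by (intro mult_nonpos_nonneg) auto
      with Ider[of "- 2 * L" u]
      show "\<exists>z. ((\<lambda>s. (D s)\<^sup>2 * exp (- 2 * L * s)) has_real_derivative z) (at u) \<and> z \<le> 0" by blast
    qed
    with True show ?thesis by simp
  next
    case False
    then have "s \<le> 0" by simp
    have "(D s)\<^sup>2 * exp (2 * L * s) \<le> (D 0)\<^sup>2 * exp (2 * L * 0)"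
    proof (rule DERIV_nonneg_imp_nondecreasing[OF \<open>s \<le> 0\<close>])
      fix u
      have "0 \<le> (2 * (D u * D' u) + (2 * L) * (D u)\<^sup>2) * exp (2 * L * u)"
        using DD'[of u] by (intro mult_nonneg_nonneg) auto
      with Ider[of "2 * L" u]
      show "\<exists>z. ((\<lambda>s. (D s)\<^sup>2 * exp (2 * L * s)) has_real_derivative z) (at u) \<and> 0 \<le> z" by blast
    qed
    with False show ?thesis by simp
  qed
  then have "(D s)\<^sup>2 \<le> (D 0)\<^sup>2 * exp (2 * L * \<bar>s\<bar>)"
    by (simp add: exp_minus field_simps)
  also have "\<dots> = (exp (L * \<bar>s\<bar>) * \<bar>D 0\<bar>)\<^sup>2"
    by (simp add: power_mult_distrib exp_double[symmetric] mult_ac)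
  finally show ?thesis
    using abs_le_square_iff[of "D s" "exp (L * \<bar>s\<bar>) * \<bar>D 0\<bar>"] by (simp add: D_def flow_0 abs_mult)
qed

text \<open>The integral of \<open>f1\<close> along the orbit from time 0, that is, the logarithm of
  the space derivative of the flow.\<close>

definition log_jac :: "real \<Rightarrow> real \<Rightarrow> real" where
  "log_jac s x = (SOME F. F 0 = 0 \<and> (\<forall>t. (F has_real_derivative f1 (flow t x)) (at t))) s"

lemma log_jac_0: "log_jac 0 x = 0"
  and log_jac_deriv: "((\<lambda>s. log_jac s x) has_real_derivative f1 (flow s x)) (at s)"
proof -
  have "L2-lipschitz_on UNIV f1"
    using nonneg f1_lipschitz by (auto simp: lipschitz_on_def dist_real_def)
  then have "continuous_on UNIV f1"
    by (rule lipschitz_on_continuous_on)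
  moreover have "continuous_on UNIV (\<lambda>t. flow t x)"
    by (rule DERIV_continuous_on[OF flow_deriv])
  ultimately have "continuous_on UNIV (\<lambda>t. f1 (flow t x))"
    using continuous_on_compose2[of UNIV f1 UNIV] by simp
  from someI_ex[OF antiderivative_real[OF this, of 0]]
  show "log_jac 0 x = 0" "((\<lambda>s. log_jac s x) has_real_derivative f1 (flow s x)) (at s)"
    unfolding log_jac_def by blast+
qed

text \<open>The solution of the linearised equation along the orbit with value 1 at time 0. The
  exponential form makes positivity and the bounds on \<open>jac\<close> and its inverse immediate;
  \<open>flow_taylor_space\<close> identifies it as the space derivative of
  \<open>flow\<close>.\<close>

definition jac :: "real \<Rightarrow> real \<Rightarrow> real" where
  "jac s x = exp (log_jac s x)"

lemma abs_log_jac_le: "\<bar>log_jac s x\<bar> \<le> L * \<bar>s\<bar>"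
  using lipschitz_of_bounded_deriv[OF log_jac_deriv f1_bound, of s x 0] by (simp add: log_jac_0)

lemma jac_le: "jac s x \<le> exp (L * \<bar>s\<bar>)" and inverse_jac_le: "1 / jac s x \<le> exp (L * \<bar>s\<bar>)"
  using abs_log_jac_le[of s x] by (auto simp: jac_def exp_minus[symmetric] divide_inverse)

lemma jac_pos: "0 < jac s x" by (simp add: jac_def)

lemma jac_deriv: "((\<lambda>s. jac s x) has_real_derivative f1 (flow s x) * jac s x) (at s)"
  unfolding jac_def by (rule derivative_eq_intros log_jac_deriv refl | simp)+

text \<open>Equivalently, \<open>\<partial>\<^sub>s\<Phi> = f(x) \<partial>\<^sub>x\<Phi>\<close>: both sides satisfy the linearised equation along the orbit.\<close>

lemma f_flow: "f (flow s x) = f x * jac s x"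
proof -
  let ?q = "\<lambda>s. f (flow s x) / jac s x"
  have "(?q has_real_derivative 0) (at s)" for s
  proof -
    have "((\<lambda>s. f (flow s x)) has_real_derivative f1 (flow s x) * f (flow s x)) (at s)"
      using DERIV_chain2[OF f_deriv flow_deriv] .
    from DERIV_divide[OF this jac_deriv[of x]] show ?thesis
      using jac_pos[of s x] by (simp add: algebra_simps)
  qed
  then have "?q s = ?q 0"
    using DERIV_isconst_all by blast
  then show ?thesis using jac_pos[of s x] by (simp add: flow_0 jac_def log_jac_0 field_simps)
qed

text \<open>Variation of constants: the error \<open>E\<close> solves the linearised equation with a
  source \<open>R\<close> quadratic in \<open>y - x\<close>, so \<open>E / jac\<close> has
  derivative \<open>R / jac\<close>. The exponent \<open>4 * L * S\<close> collects two factors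
  \<open>exp (L * S)\<close> from the squared orbit distance, one from dividing by
  \<open>jac\<close> and one from multiplying back.\<close>

lemma flow_taylor_space:
  assumes "\<bar>s\<bar> \<le> S"
  shows "\<bar>flow s y - flow s x - jac s x * (y - x)\<bar> \<le> L2 / 2 * S * exp (4 * L * S) * (y - x)\<^sup>2"
proof -
  define E where "E s = flow s y - flow s x - jac s x * (y - x)" for s
  define R where "R s = f (flow s y) - f (flow s x) - f1 (flow s x) * (flow s y - flow s x)" for s
  have S: "0 \<le> S" using assms by simp
  have der: "((\<lambda>s. E s / jac s x) has_real_derivative R s / jac s x) (at s)" for s
  proof -
    have "(E has_real_derivative f1 (flow s x) * E s + R s) (at s)"
      unfolding E_def[abs_def] R_def
      by (rule derivative_eq_intros flow_deriv jac_deriv refl | simp add: algebra_simps)+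
    from DERIV_divide[OF this jac_deriv[of x]] show ?thesis
      using jac_pos[of s x] by (simp add: field_simps)
  qed
  have R: "\<bar>R s / jac s x\<bar> \<le> L2 / 2 * exp (3 * L * S) * (y - x)\<^sup>2" if "\<bar>s\<bar> \<le> S" for s
  proof -
    have *: "exp (L * \<bar>s\<bar>) \<le> exp (L * S)"
      using that nonneg by (simp add: mult_left_mono)
    have "\<bar>flow s y - flow s x\<bar> \<le> exp (L * S) * \<bar>y - x\<bar>"
      using flow_lipschitz_space[of s y x] * by (meson mult_right_mono abs_ge_zero order_trans)
    from power_mono[OF this, of 2]
    have "(flow s y - flow s x)\<^sup>2 \<le> exp (2 * L * S) * (y - x)\<^sup>2"
      by (simp add: power_mult_distrib exp_double[symmetric] mult_ac)
    then have "\<bar>R s\<bar> \<le> L2 / 2 * (exp (2 * L * S) * (y - x)\<^sup>2)"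
      using first_order_taylor_lipschitz[OF f_deriv f1_lipschitz, of "flow s y" "flow s x"] nonneg
      unfolding R_def by (meson mult_left_mono divide_nonneg_nonneg order_trans zero_le_numeral)
    moreover have "1 / jac s x \<le> exp (L * S)"
      using inverse_jac_le[of s x] * by linarith
    ultimately have "\<bar>R s\<bar> * (1 / jac s x) \<le> L2 / 2 * (exp (2 * L * S) * (y - x)\<^sup>2) * exp (L * S)"
      using nonneg jac_pos[of s x] by (intro mult_mono) auto
    also have "\<dots> = L2 / 2 * exp (3 * L * S) * (y - x)\<^sup>2"
      by (simp add: mult_exp_exp mult_ac)
    finally show ?thesis using jac_pos[of s x] by (simp add: abs_divide)
  qed
  have "E 0 / jac 0 x = 0" by (simp add: E_def flow_0 jac_def log_jac_0)
  from abs_le_power_of_deriv[OF der this, of s "L2 / 2 * exp (3 * L * S) * (y - x)\<^sup>2" 0] R assms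
  have "\<bar>E s / jac s x\<bar> \<le> L2 / 2 * exp (3 * L * S) * (y - x)\<^sup>2 * \<bar>s\<bar>" by simp
  also have "\<dots> \<le> L2 / 2 * exp (3 * L * S) * (y - x)\<^sup>2 * S"
    using assms nonneg by (intro mult_left_mono) auto
  finally have "\<bar>E s / jac s x\<bar> * jac s x
      \<le> L2 / 2 * exp (3 * L * S) * (y - x)\<^sup>2 * S * exp (L * S)"
    using jac_le[of s x] assms nonneg S jac_pos[of s x]
    by (intro mult_mono) (auto intro: order_trans simp: mult_left_mono)
  also have "\<dots> = L2 / 2 * S * exp (4 * L * S) * (y - x)\<^sup>2"
    by (simp add: mult_exp_exp mult_ac)
  finally show ?thesis using jac_pos[of s x] by (simp add: E_def abs_divide)
qed

text \<open>Moving first the starting point and then the time reduces joint continuity to the two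
  Lipschitz bounds. It is the source of joint measurability.\<close>

lemma continuous_flow: "continuous_on UNIV (\<lambda>p. flow (fst p) (snd p))"
proof (clarsimp simp: continuous_on_eq_continuous_at continuous_at)
  fix s x
  have "((\<lambda>p. flow (fst p) (snd p) - flow s x) \<longlongrightarrow> 0) (at (s, x))"
  proof (rule Lim_null_comparison)
    show "\<forall>\<^sub>F p in at (s, x). norm (flow (fst p) (snd p) - flow s x)
        \<le> exp (L * \<bar>fst p\<bar>) * \<bar>snd p - x\<bar> + G * \<bar>fst p - s\<bar>"
    proof (rule always_eventually, rule allI)
      fix p :: "real \<times> real"
      show "norm (flow (fst p) (snd p) - flow s x)
          \<le> exp (L * \<bar>fst p\<bar>) * \<bar>snd p - x\<bar> + G * \<bar>fst p - s\<bar>"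
        using flow_lipschitz_space[of "fst p" "snd p" x] flow_lipschitz_time[of s "fst p - s" x]
        by simp
    qed
    show "((\<lambda>p. exp (L * \<bar>fst p\<bar>) * \<bar>snd p - x\<bar> + G * \<bar>fst p - s\<bar>) \<longlongrightarrow> 0) (at (s, x))"
      by (rule tendsto_eq_intros refl | simp)+
  qed
  then show "((\<lambda>p. flow (fst p) (snd p)) \<longlongrightarrow> flow s x) (at (s, x))"
    by (simp add: LIM_zero_iff)
qed

end

text \<open>\<open>v s\<close> is the payoff \<open>\<phi>\<close> transported along the flow for time \<open>s\<close> and \<open>w\<close> is its space
  derivative.\<close>

lemma (in scalar_field) transported_payoff:
  fixes \<phi> \<phi>1 :: "real \<Rightarrow> real"
  assumes \<phi>_deriv: "\<And>x. (\<phi> has_real_derivative \<phi>1 x) (at x)"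
    and \<phi>1_bound: "\<And>x. \<bar>\<phi>1 x\<bar> \<le> C1"
    and \<phi>1_lipschitz: "\<And>x y. \<bar>\<phi>1 x - \<phi>1 y\<bar> \<le> C2 * \<bar>x - y\<bar>"
  obtains v w :: "real \<Rightarrow> real \<Rightarrow> real" and K :: "real \<Rightarrow> real"
  where "\<And>x. v 0 x = \<phi> x" "\<And>s x. v s x \<in> range \<phi>"
    and "\<And>s x S. \<bar>s\<bar> \<le> S \<Longrightarrow> \<bar>w s x\<bar> \<le> K S"
    and "\<And>s x b \<xi> S. \<bar>s\<bar> \<le> S \<Longrightarrow> \<bar>\<xi>\<bar> \<le> G \<Longrightarrow>
      \<bar>v s (x + \<xi> * b) - v (s + b) x - w s x * b * (\<xi> - f x)\<bar> \<le> K S * b\<^sup>2"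
    and "(\<lambda>p. v (fst p) (snd p)) \<in> borel_measurable borel"
    and "(\<lambda>p. w (fst p) (snd p)) \<in> borel_measurable borel"
proof -
  have C: "0 \<le> C1" "0 \<le> C2"
    using \<phi>1_bound[of 0] \<phi>1_lipschitz[of 0 1] by auto
  define v where "v s x = \<phi> (flow s x)" for s x
  define w where "w s x = \<phi>1 (flow s x) * jac s x" for s x
  \<comment> \<open>\<open>K1\<close> and \<open>K2\<close> are the remainder constants of the space
    and time expansions of \<open>v\<close>. \<open>K\<close> adds the bound for \<open>w\<close>,
    so that one constant serves both conclusions; \<open>G\<^sup>2\<close> enters because the
    spatial displacement is \<open>\<xi> * b\<close>.\<close>
  define K1 where "K1 S = C2 / 2 * exp (2 * L * S) + C1 * (L2 / 2 * S * exp (4 * L * S))" for S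
  define K2 where "K2 = C2 / 2 * G\<^sup>2 + C1 * (L * G / 2)"
  define K where "K S = C1 * exp (L * S) + K1 S * G\<^sup>2 + K2" for S
  have K1_nonneg: "0 \<le> K1 S" if "0 \<le> S" for S
    unfolding K1_def using C nonneg that by (intro add_nonneg_nonneg mult_nonneg_nonneg) auto
  have K2_nonneg: "0 \<le> K2"
    unfolding K2_def using C nonneg by (intro add_nonneg_nonneg mult_nonneg_nonneg) auto
  \<comment> \<open>Here \<open>z\<close> is a linear prediction of \<open>y - x\<close>: below it
    is \<open>jac s x * (y - x)\<close> in space and \<open>b * f (flow s x)\<close> in
    time.\<close>
  have \<phi>_taylor: "\<bar>\<phi> y - \<phi> x - \<phi>1 x * z\<bar> \<le> C2 / 2 * (y - x)\<^sup>2 + C1 * \<bar>y - x - z\<bar>" for x y z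
  proof -
    have "\<phi> y - \<phi> x - \<phi>1 x * z = (\<phi> y - \<phi> x - \<phi>1 x * (y - x)) + \<phi>1 x * (y - x - z)"
      by (simp add: algebra_simps)
    moreover have "\<bar>\<phi>1 x * (y - x - z)\<bar> \<le> C1 * \<bar>y - x - z\<bar>"
      using \<phi>1_bound by (simp add: abs_mult mult_right_mono)
    ultimately show ?thesis
      using first_order_taylor_lipschitz[OF \<phi>_deriv \<phi>1_lipschitz, of y x] by linarith
  qed
  have space: "\<bar>v s y - v s x - w s x * (y - x)\<bar> \<le> K1 S * (y - x)\<^sup>2" if "\<bar>s\<bar> \<le> S" for s S x y
  proof -
    have "\<bar>flow s y - flow s x\<bar> \<le> exp (L * S) * \<bar>y - x\<bar>"
    proof -
      have "exp (L * \<bar>s\<bar>) \<le> exp (L * S)" using that nonneg by (simp add: mult_left_mono)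
      then show ?thesis
        using flow_lipschitz_space[of s y x] by (meson mult_right_mono abs_ge_zero order_trans)
    qed
    from power_mono[OF this, of 2]
    have sq: "(flow s y - flow s x)\<^sup>2 \<le> exp (2 * L * S) * (y - x)\<^sup>2"
      by (simp add: power_mult_distrib exp_double[symmetric] mult_ac)
    have "\<bar>v s y - v s x - \<phi>1 (flow s x) * (jac s x * (y - x))\<bar>
        \<le> C2 / 2 * (flow s y - flow s x)\<^sup>2 + C1 * \<bar>flow s y - flow s x - jac s x * (y - x)\<bar>"
      unfolding v_def by (rule \<phi>_taylor)
    also have "\<dots> \<le> C2 / 2 * (exp (2 * L * S) * (y - x)\<^sup>2)
        + C1 * (L2 / 2 * S * exp (4 * L * S) * (y - x)\<^sup>2)"
      using C sq flow_taylor_space[OF that] by (intro add_mono mult_left_mono) auto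
    also have "\<dots> = K1 S * (y - x)\<^sup>2" by (simp add: K1_def algebra_simps)
    finally show ?thesis by (simp add: w_def mult_ac)
  qed
  \<comment> \<open>By \<open>f_flow\<close> the time expansion has the same coefficient
    \<open>w\<close> as the space expansion, multiplied by \<open>f x\<close>. Subtracting the two
    therefore leaves only \<open>w s x * b * (\<xi> - f x)\<close> at first order.\<close>
  have time: "\<bar>v (s + b) x - v s x - w s x * b * f x\<bar> \<le> K2 * b\<^sup>2" for s b x
  proof -
    have "\<bar>v (s + b) x - v s x - \<phi>1 (flow s x) * (b * f (flow s x))\<bar>
        \<le> C2 / 2 * (flow (s + b) x - flow s x)\<^sup>2
          + C1 * \<bar>flow (s + b) x - flow s x - b * f (flow s x)\<bar>"
      unfolding v_def by (rule \<phi>_taylor)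
    also have "\<dots> \<le> C2 / 2 * (G\<^sup>2 * b\<^sup>2) + C1 * (L * G / 2 * b\<^sup>2)"
      using C flow_taylor_time[of s b x] power_mono[OF flow_lipschitz_time[of s b x], of 2]
      by (intro add_mono mult_left_mono) (auto simp: power_mult_distrib)
    also have "\<dots> = K2 * b\<^sup>2" by (simp add: K2_def algebra_simps)
    finally show ?thesis by (simp add: w_def f_flow mult_ac)
  qed
  have w_bound: "\<bar>w s x\<bar> \<le> K S" if "\<bar>s\<bar> \<le> S" for s x S
  proof -
    have "jac s x \<le> exp (L * S)"
      using jac_le[of s x] that nonneg by (meson exp_le_cancel_iff mult_left_mono order_trans)
    then have "\<bar>w s x\<bar> \<le> C1 * exp (L * S)"
      unfolding w_def using \<phi>1_bound C jac_pos[of s x]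
      by (simp add: abs_mult) (intro mult_mono, auto)
    moreover have "0 \<le> K1 S * G\<^sup>2" using K1_nonneg that by simp
    ultimately show ?thesis
      using K2_nonneg by (simp add: K_def)
  qed
  have step: "\<bar>v s (x + \<xi> * b) - v (s + b) x - w s x * b * (\<xi> - f x)\<bar> \<le> K S * b\<^sup>2"
    if "\<bar>s\<bar> \<le> S" "\<bar>\<xi>\<bar> \<le> G" for s x b \<xi> S
  proof -
    have S: "0 \<le> S" using that by simp
    have "\<bar>v s (x + \<xi> * b) - v s x - w s x * (\<xi> * b)\<bar> \<le> K1 S * (\<xi> * b)\<^sup>2"
      using space[OF that(1), of "x + \<xi> * b" x] by simp
    also have "\<dots> \<le> K1 S * (G\<^sup>2 * b\<^sup>2)"
      using that power_mono[OF that(2), of 2] K1_nonneg[OF S]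
      by (intro mult_left_mono) (auto simp: power_mult_distrib mult_right_mono)
    finally have "\<bar>v s (x + \<xi> * b) - v (s + b) x - w s x * b * (\<xi> - f x)\<bar>
        \<le> K1 S * (G\<^sup>2 * b\<^sup>2) + K2 * b\<^sup>2"
      using time[of s b x] by (simp add: algebra_simps)
    also have "\<dots> \<le> K S * b\<^sup>2"
      using C by (simp add: K_def algebra_simps)
    finally show ?thesis .
  qed
  have flow_meas: "(\<lambda>p. flow (fst p) (snd p)) \<in> borel_measurable borel"
    by (intro borel_measurable_continuous_onI continuous_flow)
  have \<phi>_cont: "continuous_on UNIV \<phi>"
    using \<phi>_deriv DERIV_continuous_on by blast
  have v_meas: "(\<lambda>p. v (fst p) (snd p)) \<in> borel_measurable borel"
    unfolding v_def
    using measurable_compose[OF flow_meas borel_measurable_continuous_onI[OF \<phi>_cont]] by simp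
  \<comment> \<open>The space expansion exhibits \<open>w\<close> as a pointwise limit of difference
    quotients of \<open>v\<close>, from which its joint measurability follows.\<close>
  have w_lim: "(\<lambda>n. (v s (x + 1 / real (Suc n)) - v s x) * real (Suc n)) \<longlonglongrightarrow> w s x" for s x
  proof -
    have "(\<lambda>n. (v s (x + 1 / real (Suc n)) - v s x) * real (Suc n) - w s x) \<longlonglongrightarrow> 0"
    proof (rule Lim_null_comparison)
      show "\<forall>\<^sub>F n in sequentially. norm ((v s (x + 1 / real (Suc n)) - v s x) * real (Suc n) - w s x)
          \<le> K1 \<bar>s\<bar> * (1 / real (Suc n))"
      proof (rule always_eventually, rule allI)
        fix n
        let ?m = "real (Suc n)"
        have "\<bar>v s (x + 1 / ?m) - v s x - w s x * (1 / ?m)\<bar> * ?m \<le> K1 \<bar>s\<bar> * (1 / ?m)\<^sup>2 * ?m"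
          using space[of s "\<bar>s\<bar>" "x + 1 / ?m" x] by (intro mult_right_mono) auto
        moreover have "\<bar>v s (x + 1 / ?m) - v s x - w s x * (1 / ?m)\<bar> * ?m
            = \<bar>(v s (x + 1 / ?m) - v s x - w s x * (1 / ?m)) * ?m\<bar>"
          by (simp add: abs_mult del: of_nat_Suc)
        moreover have "(v s (x + 1 / ?m) - v s x - w s x * (1 / ?m)) * ?m
            = (v s (x + 1 / ?m) - v s x) * ?m - w s x"
          by (simp add: left_diff_distrib del: of_nat_Suc)
        moreover have "K1 \<bar>s\<bar> * (1 / ?m)\<^sup>2 * ?m = K1 \<bar>s\<bar> * (1 / ?m)"
          by (simp add: power2_eq_square del: of_nat_Suc)
        ultimately show "norm ((v s (x + 1 / ?m) - v s x) * ?m - w s x) \<le> K1 \<bar>s\<bar> * (1 / ?m)"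
          unfolding real_norm_def by metis
      qed
      show "(\<lambda>n. K1 \<bar>s\<bar> * (1 / real (Suc n))) \<longlonglongrightarrow> 0"
        using tendsto_mult_right_zero[OF LIMSEQ_inverse_real_of_nat] by (simp add: divide_inverse)
    qed
    then show ?thesis by (simp add: LIM_zero_iff)
  qed
  have w_meas: "(\<lambda>p. w (fst p) (snd p)) \<in> borel_measurable borel"
  proof (rule borel_measurable_LIMSEQ_real[OF w_lim])
    fix n
    have "(\<lambda>p::real \<times> real. (fst p, snd p + 1 / real (Suc n))) \<in> borel \<rightarrow>\<^sub>M borel"
      by (intro borel_measurable_continuous_onI continuous_intros)
    from measurable_compose[OF this v_meas] v_meas
    show "(\<lambda>p. (v (fst p) (snd p + 1 / real (Suc n)) - v (fst p) (snd p)) * real (Suc n))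
        \<in> borel_measurable borel"
      by (auto intro!: borel_measurable_times borel_measurable_diff)
  qed
  show thesis
  proof (rule that[of v w K])
    show "v 0 x = \<phi> x" for x by (simp add: v_def flow_0)
    show "v s x \<in> range \<phi>" for s x by (simp add: v_def)
  qed (use w_bound step v_meas w_meas in blast)+
qed

subsection \<open>Gaussian averages and increments\<close>

lemma Cb_bounded: "Cb k f \<Longrightarrow> \<exists>C. \<forall>x. \<bar>f x\<bar> \<le> C"
  by (cases k) (auto simp: bounded_iff)

lemma Cb_continuous: "Cb k f \<Longrightarrow> continuous_on UNIV f"
  by (cases k) (auto simp: continuous_on_eq_continuous_within differentiable_imp_continuous_within)

lemma Cb_pair_fst_deriv:
  fixes g :: "real \<times> real \<Rightarrow> real"
  assumes "Cb (Suc k) g"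
  shows "((\<lambda>x. g (x, m)) has_real_derivative frechet_derivative g (at (x, m)) (1, 0)) (at x)"
proof -
  have "(g has_derivative frechet_derivative g (at (x, m))) (at (x, m))"
    using assms by (simp add: frechet_derivative_works)
  then have "(g \<circ> (\<lambda>x. (x, m)) has_derivative
      frechet_derivative g (at (x, m)) \<circ> (\<lambda>h. (h, 0))) (at x)"
    by (intro diff_chain_at has_derivative_Pair has_derivative_ident has_derivative_const) simp
  moreover have "frechet_derivative g (at (x, m)) \<circ> (\<lambda>h. (h, 0))
      = (*) (frechet_derivative g (at (x, m)) (1, 0))"
  proof
    fix h
    have "bounded_linear (frechet_derivative g (at (x, m)))"
      using \<open>(g has_derivative _) _\<close> has_derivative_bounded_linear by blast
    from linear_scale[OF bounded_linear.linear[OF this], of h "(1, 0)"]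
    show "(frechet_derivative g (at (x, m)) \<circ> (\<lambda>h. (h, 0))) h
        = frechet_derivative g (at (x, m)) (1, 0) * h"
      by (simp add: mult.commute)
  qed
  ultimately show ?thesis
    by (simp only: has_field_derivative_def o_def)
qed

abbreviation std_normal_measure :: "real measure" where
  "std_normal_measure \<equiv> density lborel std_normal_density"

text \<open>A non-integrable \<open>h\<close> is covered too: its integral is 0 by convention, and
  the bound at one point gives \<open>0 \<le> C\<close>.\<close>

lemma std_normal_average_le:
  fixes h :: "real \<Rightarrow> real"
  assumes "\<And>m. \<bar>h m\<bar> \<le> C"
  shows "\<bar>LINT m|std_normal_measure. h m\<bar> \<le> C"
proof (cases "integrable std_normal_measure h")
  case True
  interpret \<nu>: prob_space std_normal_measure
    by (rule prob_space_normal_density) simp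
  have "\<bar>LINT m|std_normal_measure. h m\<bar> \<le> (LINT m|std_normal_measure. \<bar>h m\<bar>)"
    by (rule integral_abs_bound)
  also have "\<dots> \<le> C"
    by (rule \<nu>.integral_le_const) (use True assms in auto)
  finally show ?thesis .
next
  case False
  then show ?thesis
    using assms[of 0] by (simp add: not_integrable_integral_eq)
qed

text \<open>The first-order Taylor bound for \<open>g\<close> in its first argument is uniform in
  \<open>m\<close>. Integrating it over the Gaussian law differentiates the average directly, with
  error at most \<open>L2 / 2 * \<bar>y - x\<bar>\<close> in the difference quotient.
  \<open>L\<close> and \<open>L2\<close> bound the first and second derivatives of \<open>g\<close>
  in that argument.\<close>

lemma averaged_scalar_field:
  assumes g: "Cb 3 g" and G: "\<And>p. \<bar>g p\<bar> \<le> G"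
  obtains f1 L L2 where "scalar_field (averaged g) f1 G L L2"
proof -
  interpret \<nu>: prob_space std_normal_measure
    by (rule prob_space_normal_density) simp
  define g1 where "g1 p = frechet_derivative g (at p) (1, 0)" for p
  have g': "Cb (Suc 2) g" using g by (simp add: numeral_3_eq_3 numeral_2_eq_2)
  have "Cb 2 g1"
    using g' unfolding Cb_Suc_pair g1_def[abs_def] by blast
  then have g1: "Cb (Suc 1) g1"
    by (simp only: Suc_1)
  have der: "((\<lambda>x. g (x, m)) has_real_derivative g1 (x, m)) (at x)" for x m
    unfolding g1_def by (rule Cb_pair_fst_deriv[OF g'])
  obtain L where L: "\<And>p. \<bar>g1 p\<bar> \<le> L"
    using Cb_bounded[OF g1] by blast
  have "Cb 1 (\<lambda>p. frechet_derivative g1 (at p) (1, 0))"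
    using g1 unfolding Cb_Suc_pair by blast
  then obtain L2 where L2: "\<And>p. \<bar>frechet_derivative g1 (at p) (1, 0)\<bar> \<le> L2"
    using Cb_bounded by blast
  have lip: "\<bar>g1 (x, m) - g1 (y, m)\<bar> \<le> L2 * \<bar>x - y\<bar>" for x y m
    by (rule lipschitz_of_bounded_deriv[OF Cb_pair_fst_deriv[OF g1] L2])
  have int: "integrable std_normal_measure (\<lambda>m. h (x, m))"
    if "continuous_on UNIV h" "\<And>p. \<bar>h p\<bar> \<le> C" for h :: "real \<times> real \<Rightarrow> real" and x C
  proof (rule \<nu>.integrable_const_bound[of _ C])
    have "continuous_on UNIV (\<lambda>m. h (x, m))"
      by (rule continuous_on_compose2[OF that(1)]) (auto intro!: continuous_intros)
    then show "(\<lambda>m. h (x, m)) \<in> borel_measurable std_normal_measure"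
      using borel_measurable_continuous_onI by simp
  qed (use that in simp)
  note gint = int[OF Cb_continuous[OF g] G] and g1int = int[OF Cb_continuous[OF g1] L]
  have taylor: "\<bar>averaged g y - averaged g x - averaged g1 x * (y - x)\<bar> \<le> L2 / 2 * (y - x)\<^sup>2" for x y
  proof -
    have "averaged g y - averaged g x - averaged g1 x * (y - x)
        = (LINT m|std_normal_measure. g (y, m) - g (x, m) - g1 (x, m) * (y - x))"
      unfolding averaged_def using gint g1int by simp
    moreover have "\<bar>LINT m|std_normal_measure. g (y, m) - g (x, m) - g1 (x, m) * (y - x)\<bar>
        \<le> L2 / 2 * (y - x)\<^sup>2"
      by (intro std_normal_average_le first_order_taylor_lipschitz[OF der lip])
    ultimately show ?thesis by simp
  qed
  have "scalar_field (averaged g) (averaged g1) G L L2"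
  proof
    show "\<bar>averaged g x\<bar> \<le> G" for x
      unfolding averaged_def by (rule std_normal_average_le[OF G])
    show "\<bar>averaged g1 x\<bar> \<le> L" for x
      unfolding averaged_def by (rule std_normal_average_le[OF L])
    show "\<bar>averaged g1 x - averaged g1 y\<bar> \<le> L2 * \<bar>x - y\<bar>" for x y
      using std_normal_average_le[of "\<lambda>m. g1 (x, m) - g1 (y, m)", OF lip] g1int
      by (simp add: averaged_def)
    show "(averaged g has_real_derivative averaged g1 x) (at x)" for x
      unfolding has_field_derivative_iff
    proof (subst LIM_zero_iff[symmetric], rule Lim_null_comparison)
      show "\<forall>\<^sub>F y in at x. norm ((averaged g y - averaged g x) / (y - x) - averaged g1 x)
          \<le> L2 / 2 * \<bar>y - x\<bar>"
        unfolding eventually_at_filter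
      proof (intro always_eventually allI impI)
        fix y assume "y \<noteq> x"
        then have "(averaged g y - averaged g x) / (y - x) - averaged g1 x
            = (averaged g y - averaged g x - averaged g1 x * (y - x)) / (y - x)"
          by (simp add: diff_divide_distrib)
        then show "norm ((averaged g y - averaged g x) / (y - x) - averaged g1 x)
            \<le> L2 / 2 * \<bar>y - x\<bar>"
          using taylor[of y x] \<open>y \<noteq> x\<close>
          by (simp add: abs_divide pos_divide_le_eq power2_eq_square mult.assoc)
      qed
      show "((\<lambda>y. L2 / 2 * \<bar>y - x\<bar>) \<longlongrightarrow> 0) (at x)"
        by (rule tendsto_eq_intros refl | simp)+
    qed
  qed
  then show thesis by (rule that)
qed

section \<open>Second moments of Gaussian variables and of fractional increments\<close>

lemma gaussian_rv_square_integrable: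
  assumes "prob_space M" "gaussian_rv M X"
  shows "integrable M (\<lambda>\<omega>. (X \<omega>)\<^sup>2)"
proof -
  interpret prob_space M by fact
  have X[measurable]: "X \<in> borel_measurable M" using assms by (simp add: gaussian_rv_def)
  from assms(2) obtain \<mu> where
    "(AE \<omega> in M. X \<omega> = \<mu>) \<or> (\<exists>\<sigma>>0. distributed M lborel X (normal_density \<mu> \<sigma>))"
    by (auto simp: gaussian_rv_def)
  then show ?thesis
  proof (elim disjE exE conjE)
    assume "AE \<omega> in M. X \<omega> = \<mu>"
    then have "AE \<omega> in M. \<mu>\<^sup>2 = (X \<omega>)\<^sup>2" by eventually_elim simp
    then show ?thesis
      by (rule integrable_cong_AE_imp[rotated 2]) auto
  next
    fix \<sigma> :: real assume \<sigma>: "0 < \<sigma>" and D: "distributed M lborel X (normal_density \<mu> \<sigma>)"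
    \<comment> \<open>The expansion of \<open>x\<^sup>2\<close> about \<open>\<mu>\<close> reduces
      the claim to central moments.\<close>
    have "integrable lborel (\<lambda>x. normal_density \<mu> \<sigma> x * (x - \<mu>) ^ 2
        + 2 * \<mu> * (normal_density \<mu> \<sigma> x * (x - \<mu>) ^ 1)
        + \<mu>\<^sup>2 * (normal_density \<mu> \<sigma> x * (x - \<mu>) ^ 0))"
      using integrable_normal_moment[OF \<sigma>, of \<mu>]
      by (intro Bochner_Integration.integrable_add integrable_mult_right)
    then have "integrable lborel (\<lambda>x. normal_density \<mu> \<sigma> x * x\<^sup>2)"
      by (rule Bochner_Integration.integrable_cong[THEN iffD1, OF refl, rotated])
        (simp add: power2_eq_square algebra_simps)
    then show ?thesis
      using distributed_integrable[OF D, of "\<lambda>x. x\<^sup>2"] normal_density_nonneg by simp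
  qed
qed

lemma fbm_measurable:
  assumes "fractional_brownian_motion M H Z" "0 \<le> t"
  shows "Z t \<in> borel_measurable M" and "gaussian_rv M (Z t)"
proof -
  have "gaussian_rv M (\<lambda>\<omega>. \<Sum>s\<in>{t}. 1 * Z s \<omega>)"
    using assms unfolding fractional_brownian_motion_def gaussian_process_def
    by (elim conjE allE[of _ "{t}"] allE[of _ "\<lambda>_. 1"]) simp
  then show "gaussian_rv M (Z t)" by simp
  then show "Z t \<in> borel_measurable M" by (simp add: gaussian_rv_def)
qed

text \<open>Integrability is derived first from the Gaussian marginals, since an integral equal to 0
  could be the default value. Expanding the square and using the covariance at
  \<open>(s, s)\<close>, \<open>(t, t)\<close> and \<open>(s, t)\<close> then leaves the power of
  \<open>\<bar>t - s\<bar>\<close>.\<close>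

lemma fbm_increment_variance:
  assumes "prob_space M" and Z: "fractional_brownian_motion M H Z" and st: "0 \<le> s" "0 \<le> t"
  shows "integrable M (\<lambda>\<omega>. (Z t \<omega> - Z s \<omega>)\<^sup>2)"
    and "(LINT \<omega>|M. (Z t \<omega> - Z s \<omega>)\<^sup>2) = \<bar>t - s\<bar> powr (2 * H)"
proof -
  note [measurable] = fbm_measurable(1)[OF Z st(1)] fbm_measurable(1)[OF Z st(2)]
  have sq: "integrable M (\<lambda>\<omega>. (Z r \<omega>)\<^sup>2)" if "0 \<le> r" for r
    by (rule gaussian_rv_square_integrable[OF assms(1) fbm_measurable(2)[OF Z that]])
  have "integrable M (\<lambda>\<omega>. (Z s \<omega>)\<^sup>2 + (Z t \<omega>)\<^sup>2)"
    using sq st by simp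
  then have prod: "integrable M (\<lambda>\<omega>. Z s \<omega> * Z t \<omega>)"
  proof (rule Bochner_Integration.integrable_bound)
    show "AE \<omega> in M. norm (Z s \<omega> * Z t \<omega>) \<le> norm ((Z s \<omega>)\<^sup>2 + (Z t \<omega>)\<^sup>2)"
    proof (rule AE_I2)
      fix \<omega>
      have "2 * \<bar>Z s \<omega>\<bar> * \<bar>Z t \<omega>\<bar> \<le> \<bar>Z s \<omega>\<bar>\<^sup>2 + \<bar>Z t \<omega>\<bar>\<^sup>2"
        by (rule sum_squares_bound)
      moreover have "0 \<le> \<bar>Z s \<omega>\<bar> * \<bar>Z t \<omega>\<bar>" by simp
      ultimately show "norm (Z s \<omega> * Z t \<omega>) \<le> norm ((Z s \<omega>)\<^sup>2 + (Z t \<omega>)\<^sup>2)"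
        unfolding real_norm_def abs_mult power2_abs by linarith
    qed
  qed simp
  have expand: "(Z t \<omega> - Z s \<omega>)\<^sup>2 = (Z t \<omega>)\<^sup>2 + (Z s \<omega>)\<^sup>2 - 2 * (Z s \<omega> * Z t \<omega>)" for \<omega>
    by (simp add: power2_diff)
  show "integrable M (\<lambda>\<omega>. (Z t \<omega> - Z s \<omega>)\<^sup>2)"
    unfolding expand using sq st prod by simp
  have cov: "(LINT \<omega>|M. Z s \<omega> * Z t \<omega>) =
      (s powr (2 * H) + t powr (2 * H) - \<bar>t - s\<bar> powr (2 * H)) / 2" if "0 \<le> s" "0 \<le> t" for s t
    using Z that unfolding fractional_brownian_motion_def by blast
  have "(LINT \<omega>|M. (Z t \<omega> - Z s \<omega>)\<^sup>2)
      = (LINT \<omega>|M. (Z t \<omega>)\<^sup>2) + (LINT \<omega>|M. (Z s \<omega>)\<^sup>2) - 2 * (LINT \<omega>|M. Z s \<omega> * Z t \<omega>)"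
    unfolding expand using sq st prod by simp
  moreover have "(LINT \<omega>|M. (Z r \<omega>)\<^sup>2) = r powr (2 * H)" if "0 \<le> r" for r
    using cov[OF that that] by (simp add: power2_eq_square)
  ultimately show "(LINT \<omega>|M. (Z t \<omega> - Z s \<omega>)\<^sup>2) = \<bar>t - s\<bar> powr (2 * H)"
    using cov[OF st] st by (simp add: field_simps)
qed

text \<open>The library's \<open>indep_var\<close> forces both variables to have the same type.\<close>

lemma (in prob_space) distr_pair_indep:
  assumes sub: "subalgebra M F" and Y: "Y \<in> F \<rightarrow>\<^sub>M S" and \<gamma>[measurable]: "\<gamma> \<in> M \<rightarrow>\<^sub>M R"
    and indep: "indep_set (sets F) {\<gamma> -` A \<inter> space M | A. A \<in> sets R}"
  shows "distr M (S \<Otimes>\<^sub>M R) (\<lambda>\<omega>. (Y \<omega>, \<gamma> \<omega>)) = distr M S Y \<Otimes>\<^sub>M distr M R \<gamma>"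
proof (rule pair_measure_eqI[symmetric])
  have [measurable]: "Y \<in> M \<rightarrow>\<^sub>M S" by (rule measurable_from_subalg[OF sub Y])
  show "sigma_finite_measure (distr M S Y)" "sigma_finite_measure (distr M R \<gamma>)"
    by (auto intro!: prob_space_imp_sigma_finite prob_space_distr)
  show "sets (distr M S Y \<Otimes>\<^sub>M distr M R \<gamma>) = sets (distr M (S \<Otimes>\<^sub>M R) (\<lambda>\<omega>. (Y \<omega>, \<gamma> \<omega>)))"
    by simp
  fix A B assume "A \<in> sets (distr M S Y)" "B \<in> sets (distr M R \<gamma>)"
  then have [measurable]: "A \<in> sets S" "B \<in> sets R" by auto
  have "Y -` A \<inter> space M \<in> sets F"
    using measurable_sets[OF Y, of A] sub by (simp add: subalgebra_def)
  moreover have "\<gamma> -` B \<inter> space M \<in> {\<gamma> -` A \<inter> space M | A. A \<in> sets R}"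
    using \<open>B \<in> sets R\<close> by blast
  ultimately have "prob ((Y -` A \<inter> space M) \<inter> (\<gamma> -` B \<inter> space M))
      = prob (Y -` A \<inter> space M) * prob (\<gamma> -` B \<inter> space M)"
    by (rule indep_setD[OF indep])
  moreover have "(\<lambda>\<omega>. (Y \<omega>, \<gamma> \<omega>)) -` (A \<times> B) \<inter> space M
      = (Y -` A \<inter> space M) \<inter> (\<gamma> -` B \<inter> space M)" by auto
  ultimately show "emeasure (distr M S Y) A * emeasure (distr M R \<gamma>) B
      = emeasure (distr M (S \<Otimes>\<^sub>M R) (\<lambda>\<omega>. (Y \<omega>, \<gamma> \<omega>))) (A \<times> B)"
    by (simp add: emeasure_distr emeasure_eq_measure ennreal_mult)
qed

text \<open>Independence makes the law of \<open>((U, X), \<gamma>)\<close> a product; by Fubini one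
  integrates over the noise first, and for frozen \<open>X\<close> the fluctuation of
  \<open>g\<close> around \<open>averaged g\<close> has mean 0.\<close>

lemma (in prob_space) indep_average_zero:
  fixes g :: "real \<times> real \<Rightarrow> real"
  assumes sub: "subalgebra M F"
    and UX: "U \<in> borel_measurable F" "X \<in> borel_measurable F"
    and \<gamma>[measurable]: "\<gamma> \<in> borel_measurable M"
    and indep: "indep_set (sets F) {\<gamma> -` A \<inter> space M | A. A \<in> sets borel}"
    and distr: "distr M borel \<gamma> = std_normal_measure"
    and U: "\<And>\<omega>. \<bar>U \<omega>\<bar> \<le> c"
    and g: "g \<in> borel_measurable borel" "\<And>p. \<bar>g p\<bar> \<le> G"
  shows "(LINT \<omega>|M. U \<omega> * (g (X \<omega>, \<gamma> \<omega>) - averaged g (X \<omega>))) = 0"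
proof -
  let ?Y = "\<lambda>\<omega>. (U \<omega>, X \<omega>)" and ?D = "distr M (borel \<Otimes>\<^sub>M borel) (\<lambda>\<omega>. (U \<omega>, X \<omega>))"
  have Y: "?Y \<in> F \<rightarrow>\<^sub>M borel \<Otimes>\<^sub>M borel" using UX by simp
  have [measurable]: "?Y \<in> M \<rightarrow>\<^sub>M borel \<Otimes>\<^sub>M borel" by (rule measurable_from_subalg[OF sub Y])
  interpret \<nu>: prob_space std_normal_measure
    by (rule prob_space_normal_density) simp
  interpret D: prob_space ?D
    by (rule prob_space_distr) simp
  interpret P: pair_prob_space ?D std_normal_measure ..
  have g'[measurable]: "g \<in> borel_measurable (borel \<Otimes>\<^sub>M borel)"
    using g(1) by (simp add: borel_prod)
  have avg[measurable]: "averaged g \<in> borel_measurable borel"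
    unfolding averaged_def by measurable
  have avg_le: "\<bar>averaged g x\<bar> \<le> G" for x
    unfolding averaged_def
    by (rule std_normal_average_le[OF g(2)])
  have gint: "integrable std_normal_measure (\<lambda>m. g (x, m))" for x
    by (rule \<nu>.integrable_const_bound[of _ G]) (use g(2) in simp_all)
  \<comment> \<open>Truncation at \<open>c\<close> leaves \<open>U\<close> unchanged but makes
    \<open>?h\<close> bounded on the whole product space, as integrability there requires.\<close>
  let ?h = "\<lambda>(p, m). max (- c) (min c (fst p)) * (g (snd p, m) - averaged g (snd p))"
  have c: "0 \<le> c" "0 \<le> G" using U[of undefined] g(2)[of undefined] by auto
  have h_le: "\<bar>?h z\<bar> \<le> c * (2 * G)" for z
  proof (cases z)
    case (Pair p m)
    have "\<bar>g (snd p, m) - averaged g (snd p)\<bar> \<le> 2 * G"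
      using g(2)[of "(snd p, m)"] avg_le[of "snd p"] by linarith
    moreover have "\<bar>max (- c) (min c (fst p))\<bar> \<le> c" using c by auto
    ultimately show ?thesis
      using c by (simp add: Pair abs_mult mult_mono)
  qed
  have h_meas[measurable]: "?h \<in> borel_measurable ((borel \<Otimes>\<^sub>M borel) \<Otimes>\<^sub>M borel)"
    by measurable
  have trunc: "max (- c) (min c (U \<omega>)) = U \<omega>" for \<omega>
    using U[of \<omega>] by auto
  have "(LINT \<omega>|M. U \<omega> * (g (X \<omega>, \<gamma> \<omega>) - averaged g (X \<omega>))) = (LINT \<omega>|M. ?h (?Y \<omega>, \<gamma> \<omega>))"
    by (simp add: trunc)
  also have "\<dots> = (LINT z|distr M ((borel \<Otimes>\<^sub>M borel) \<Otimes>\<^sub>M borel) (\<lambda>\<omega>. (?Y \<omega>, \<gamma> \<omega>)). ?h z)"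
    by (rule integral_distr[symmetric]) measurable
  also have "distr M ((borel \<Otimes>\<^sub>M borel) \<Otimes>\<^sub>M borel) (\<lambda>\<omega>. (?Y \<omega>, \<gamma> \<omega>)) = ?D \<Otimes>\<^sub>M std_normal_measure"
    using distr_pair_indep[OF sub Y \<gamma> indep] by (simp add: distr)
  also have "(LINT z|(?D \<Otimes>\<^sub>M std_normal_measure). ?h z)
      = (LINT p|?D. LINT m|std_normal_measure. ?h (p, m))"
  proof (rule P.integral_fst'[symmetric])
    show "integrable (?D \<Otimes>\<^sub>M std_normal_measure) ?h"
      by (rule P.integrable_const_bound[of _ "c * (2 * G)"]) (use h_le in auto)
  qed
  also have "\<dots> = 0"
  proof -
    have "(LINT m|std_normal_measure. ?h (p, m)) = 0" for p
      using gint \<nu>.prob_space by (simp add: averaged_def)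
    then show ?thesis by (simp only: Bochner_Integration.integral_zero)
  qed
  finally show ?thesis .
qed

subsection \<open>Independence of the noise from the past\<close>

lemma space_process_sigma: "space (process_sigma M Z) = space M"
  by (simp add: process_sigma_def space_measure_of_conv)

lemma process_measurable:
  assumes "0 \<le> t"
  shows "Z t \<in> borel_measurable (process_sigma M Z)"
proof (rule measurableI)
  fix A :: "real set" assume "A \<in> sets borel"
  then have "Z t -` A \<inter> space M \<in> sets (process_sigma M Z)"
    unfolding process_sigma_def using assms by (subst sets_measure_of) auto
  then show "Z t -` A \<inter> space (process_sigma M Z) \<in> sets (process_sigma M Z)"
    by (simp add: space_process_sigma)
qed simp

lemma subalgebra_process_sigma:
  assumes "\<And>t. 0 \<le> t \<Longrightarrow> Z t \<in> borel_measurable M"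
  shows "subalgebra M (process_sigma M Z)"
proof -
  have "sets (process_sigma M Z) \<subseteq> sets M"
    unfolding process_sigma_def
    using assms by (subst sets_measure_of) (auto intro!: sets.sigma_sets_subset)
  then show ?thesis by (simp add: subalgebra_def space_process_sigma)
qed

lemma scaled_increment_distr:
  assumes "prob_space M" "brownian_motion M B" "0 < dt"
  shows "distr M borel (scaled_increment B dt n) = std_normal_measure"
proof -
  interpret prob_space M by fact
  have "distributed M lborel (\<lambda>\<omega>. B (real (Suc n) * dt) \<omega> - B (real n * dt) \<omega>)
      (normal_density 0 (sqrt (real (Suc n) * dt - real n * dt)))"
    using assms unfolding brownian_motion_def by (elim conjE allE impE) auto
  moreover have "real (Suc n) * dt - real n * dt = dt" by (simp add: algebra_simps)
  ultimately have "distributed M lborel (\<lambda>\<omega>. B (real (Suc n) * dt) \<omega> - B (real n * dt) \<omega>)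
      (normal_density 0 (sqrt dt))" by simp
  from normal_density_affine[OF this, of "dt powr (- 1 / 2)" 0]
  have "distributed M lborel (scaled_increment B dt n)
      (normal_density 0 (\<bar>dt powr (- 1 / 2)\<bar> * sqrt dt))"
    using assms(3) by (simp add: scaled_increment_def[abs_def])
  moreover have "\<bar>dt powr (- 1 / 2)\<bar> * sqrt dt = 1"
    using assms(3) by (simp add: powr_half_sqrt[symmetric] powr_add[symmetric])
  ultimately have "distr M lborel (scaled_increment B dt n) = std_normal_measure"
    by (simp add: distributed_distr_eq_density)
  then show ?thesis by (metis distr_cong sets_lborel)
qed

text \<open>The sigma-algebra is general because the fact is used both for \<open>M\<close> and for
  \<open>process_sigma M B\<close>.\<close>

lemma scaled_increment_measurable:
  assumes "\<And>t. 0 \<le> t \<Longrightarrow> B t \<in> borel_measurable F" "0 < dt"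
  shows "scaled_increment B dt n \<in> borel_measurable F"
proof -
  have t: "0 \<le> real (Suc n) * dt" "0 \<le> real n * dt" using assms(2) by auto
  note [measurable] = assms(1)[OF t(1)] assms(1)[OF t(2)]
  show ?thesis unfolding scaled_increment_def[abs_def] by measurable
qed

lemma scaled_increment_indep:
  assumes "prob_space M" "brownian_motion M B" "0 < dt"
  shows "prob_space.indep_vars M (\<lambda>_. borel) (scaled_increment B dt) {..<n}"
proof -
  interpret prob_space M by fact
  have "\<forall>(\<tau> :: nat \<Rightarrow> real) n. 0 \<le> \<tau> 0 \<longrightarrow> (\<forall>i<n. \<tau> i \<le> \<tau> (Suc i)) \<longrightarrow>
      indep_vars (\<lambda>_. borel) (\<lambda>i \<omega>. B (\<tau> (Suc i)) \<omega> - B (\<tau> i) \<omega>) {..<n}"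
    using assms(2) unfolding brownian_motion_def by blast
  from this[rule_format, of "\<lambda>i. real i * dt" n] assms(3)
  have "indep_vars (\<lambda>_. borel) (\<lambda>i \<omega>. B (real (Suc i) * dt) \<omega> - B (real i * dt) \<omega>) {..<n}"
    by (simp add: mult_right_mono)
  from indep_vars_compose2[OF this, of "\<lambda>_ y. dt powr (- 1 / 2) * y" "\<lambda>_. borel"]
  show ?thesis by (simp add: scaled_increment_def[abs_def])
qed

text \<open>Index \<open>0\<close> carries the whole process \<open>\<beta>\<close>, index \<open>k + 1\<close> the noise variable \<open>\<gamma>\<^sub>k\<close>.\<close>

definition past_sigma ::
  "'a measure \<Rightarrow> (real \<Rightarrow> 'a \<Rightarrow> real) \<Rightarrow> (real \<Rightarrow> 'a \<Rightarrow> real) \<Rightarrow> real \<Rightarrow> nat \<Rightarrow> 'a measure" where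
  "past_sigma M \<beta> B dt n = sigma (space M) (\<Union>i\<le>n. case i of 0 \<Rightarrow> sets (process_sigma M \<beta>)
     | Suc k \<Rightarrow> {scaled_increment B dt k -` A \<inter> space M | A. A \<in> sets borel})"

lemma past_sigma_generators:
  "(\<Union>i\<le>n. case i of 0 \<Rightarrow> sets (process_sigma M \<beta>)
     | Suc k \<Rightarrow> {scaled_increment B dt k -` A \<inter> space M | A. A \<in> sets borel}) \<subseteq> Pow (space M)"
  using sets.space_closed[of "process_sigma M \<beta>"]
  by (auto simp: space_process_sigma split: nat.splits)

lemma space_past_sigma: "space (past_sigma M \<beta> B dt n) = space M"
  by (simp add: past_sigma_def space_measure_of_conv)

lemma sets_past_sigma:
  "sets (past_sigma M \<beta> B dt n) = sigma_sets (space M) (\<Union>i\<le>n. case i of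
     0 \<Rightarrow> sets (process_sigma M \<beta>)
     | Suc k \<Rightarrow> {scaled_increment B dt k -` A \<inter> space M | A. A \<in> sets borel})"
  unfolding past_sigma_def by (rule sets_measure_of[OF past_sigma_generators])

lemma measurable_past_sigma_process:
  "borel_measurable (process_sigma M \<beta>) \<subseteq> borel_measurable (past_sigma M \<beta> B dt n)"
proof (rule measurable_mono)
  show "sets (process_sigma M \<beta>) \<subseteq> sets (past_sigma M \<beta> B dt n)"
    unfolding sets_past_sigma by (auto intro!: sigma_sets.Basic bexI[of _ "0::nat"])
qed (simp_all add: space_past_sigma space_process_sigma)

lemma scaled_increment_past_measurable:
  assumes "k < n"
  shows "scaled_increment B dt k \<in> borel_measurable (past_sigma M \<beta> B dt n)"
proof (rule measurableI)
  fix A :: "real set" assume "A \<in> sets borel"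
  then have "scaled_increment B dt k -` A \<inter> space M \<in> sets (past_sigma M \<beta> B dt n)"
    unfolding sets_past_sigma using assms
    by (intro sigma_sets.Basic UN_I[of "Suc k"]) auto
  then show "scaled_increment B dt k -` A \<inter> space (past_sigma M \<beta> B dt n)
      \<in> sets (past_sigma M \<beta> B dt n)"
    by (simp add: space_past_sigma)
qed simp

lemma subalgebra_past_sigma:
  assumes "subalgebra M (process_sigma M \<beta>)" "\<And>k. scaled_increment B dt k \<in> borel_measurable M"
  shows "subalgebra M (past_sigma M \<beta> B dt n)"
proof -
  have "sets (past_sigma M \<beta> B dt n) \<subseteq> sets M"
    unfolding sets_past_sigma
  proof (intro sets.sigma_sets_subset UN_least)
    fix i
    show "(case i of 0 \<Rightarrow> sets (process_sigma M \<beta>)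
        | Suc k \<Rightarrow> {scaled_increment B dt k -` A \<inter> space M | A. A \<in> sets borel}) \<subseteq> sets M"
      using assms by (cases i) (auto simp: subalgebra_def intro: measurable_sets)
  qed
  then show ?thesis by (simp add: subalgebra_def space_past_sigma)
qed

text \<open>The family consisting of all events of \<open>\<beta>\<close> and the events of each
  single noise variable is mutually independent: the increments of \<open>B\<close> are independent
  among themselves, and \<open>\<beta>\<close> is independent of \<open>B\<close> as a whole.
  Grouping then separates the last noise variable from all the rest.\<close>

lemma past_sigma_indep_increment:
  assumes "prob_space M" and B: "brownian_motion M B" and indep: "indep_processes M B \<beta>"
    and dt: "0 < dt"
  shows "prob_space.indep_set M (sets (past_sigma M \<beta> B dt n))
    {scaled_increment B dt n -` A \<inter> space M | A. A \<in> sets borel}"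
proof -
  interpret prob_space M by fact
  let ?S = "\<lambda>k. {scaled_increment B dt k -` A \<inter> space M | A. A \<in> sets borel}"
  let ?E = "\<lambda>i. case i of 0 \<Rightarrow> sets (process_sigma M \<beta>) | Suc k \<Rightarrow> ?S k"
  have ind: "indep_set (sets (process_sigma M B)) (sets (process_sigma M \<beta>))"
    using indep by (simp add: indep_processes_def)
  have B_meas: "\<And>t. 0 \<le> t \<Longrightarrow> B t \<in> borel_measurable M"
    using B by (simp add: brownian_motion_def)
  have space_S: "space M \<in> ?S k" for k by (auto intro!: exI[of _ UNIV])
  have S_events: "?S k \<subseteq> events" for k
    using scaled_increment_measurable[OF B_meas dt] by (auto intro: measurable_sets)
  have E_events: "?E i \<subseteq> events" for i
    using indep_setD_ev2[OF ind] S_events by (cases i) auto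
  have space_E: "space M \<in> ?E i" for i
    using space_S sets.top[of "process_sigma M \<beta>"]
    by (cases i) (auto simp: space_process_sigma simp del: sets.top)
  have "indep_vars (\<lambda>_. borel) (scaled_increment B dt) {..<Suc n}"
    by (rule scaled_increment_indep[OF assms(1) B dt])
  then have "indep_sets ?S {..<Suc n}"
    unfolding indep_vars_def2 by blast
  then have S_prod: "prob (\<Inter>k\<le>n. A k) = (\<Prod>k\<le>n. prob (A k))"
    if "\<And>k. k \<le> n \<Longrightarrow> A k \<in> ?S k" for A
    using that by (intro indep_setsD) (auto simp: lessThan_Suc_atMost)
  \<comment> \<open>Each \<open>?E i\<close> contains the whole space, so the product formula need
    only be tested on the full index set.\<close>
  have E: "indep_sets ?E {..Suc n}"
  proof (subst indep_sets_finite)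
    show "\<forall>A\<in>Pi {..Suc n} ?E. prob (\<Inter>j\<in>{..Suc n}. A j) = (\<Prod>j\<in>{..Suc n}. prob (A j))"
    proof
      fix A assume A: "A \<in> Pi {..Suc n} ?E"
      have A0: "A 0 \<in> sets (process_sigma M \<beta>)"
        using Pi_mem[OF A, of 0] by simp
      have AS: "A (Suc k) \<in> ?S k" if "k \<le> n" for k
        using Pi_mem[OF A, of "Suc k"] that by simp
      have "A (Suc k) \<in> sets (process_sigma M B)" if k: "k \<le> n" for k
      proof -
        obtain C where C: "C \<in> sets borel" "A (Suc k) = scaled_increment B dt k -` C \<inter> space M"
          using AS[OF k] by blast
        from measurable_sets[OF scaled_increment_measurable[OF process_measurable dt] C(1)]
        show ?thesis by (simp add: C(2) space_process_sigma)
      qed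
      \<comment> \<open>The noise events together form one event of
        \<open>process_sigma M B\<close>; independence of the processes splits off
        \<open>A 0\<close>, and \<open>S_prod\<close> factorises the remainder.\<close>
      then have "(\<Inter>k\<le>n. A (Suc k)) \<in> sets (process_sigma M B)"
        by (intro sets.finite_INT) auto
      from indep_setD[OF ind this A0] S_prod[OF AS]
      have "prob ((\<Inter>k\<le>n. A (Suc k)) \<inter> A 0) = (\<Prod>k\<le>n. prob (A (Suc k))) * prob (A 0)"
        by simp
      moreover have "(\<Inter>j\<in>{..Suc n}. A j) = (\<Inter>k\<le>n. A (Suc k)) \<inter> A 0"
        unfolding atMost_Suc_eq_insert_0 by (auto simp: image_image)
      ultimately show "prob (\<Inter>j\<in>{..Suc n}. A j) = (\<Prod>j\<in>{..Suc n}. prob (A j))"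
        by (simp only: prod.atMost_Suc_shift mult.commute)
    qed
  qed (use E_events space_E in auto)
  \<comment> \<open>The indices \<open>{..n}\<close> generate
    \<open>past_sigma M \<beta> B dt n\<close>, whereas the noise variable numbered \<open>n\<close>
    has index \<open>Suc n\<close>.\<close>
  have "indep_sets (\<lambda>j. sigma_sets (space M) (\<Union>i\<in>case_bool {..n} {Suc n} j. ?E i)) UNIV"
  proof (rule indep_sets_collect_sigma)
    have "(\<Union>j. case_bool {..n} {Suc n} j) = {..Suc n}"
      by (auto simp: UNIV_bool)
    with E show "indep_sets ?E (\<Union>j. case_bool {..n} {Suc n} j)" by simp
    show "Int_stable (?E i)" for i
    proof (cases i)
      case 0
      then show ?thesis by (auto simp: Int_stable_def)
    next
      case (Suc k)
      have "Int_stable (?S k)"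
      proof (rule Int_stableI)
        fix a b assume "a \<in> ?S k" "b \<in> ?S k"
        then obtain C D where "C \<in> sets borel" "D \<in> sets borel"
          "a = scaled_increment B dt k -` C \<inter> space M" "b = scaled_increment B dt k -` D \<inter> space M"
          by blast
        then show "a \<inter> b \<in> ?S k" by (intro CollectI exI[of _ "C \<inter> D"]) auto
      qed
      with Suc show ?thesis by simp
    qed
    show "disjoint_family_on (case_bool {..n} {Suc n}) UNIV"
      by (auto simp: disjoint_family_on_def split: bool.splits)
  qed
  then have *: "indep_sets (case_bool (sets (past_sigma M \<beta> B dt n))
      (sigma_sets (space M) (?S n))) UNIV"
    by (rule indep_sets_cong[THEN iffD1, rotated 2])
      (auto simp: sets_past_sigma split: bool.split)
  have "indep_sets (case_bool (sets (past_sigma M \<beta> B dt n)) (?S n)) UNIV"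
    by (rule indep_sets_mono_sets[OF *]) (auto intro: sigma_sets.Basic split: bool.split)
  then show ?thesis by (simp add: indep_set_def)
qed

subsection \<open>The weak error\<close>

text \<open>The expectation of \<open>e * v (\<sigma> n) (Y n)\<close> is telescoped over
  \<open>n\<close>. The slope \<open>\<xi>\<close> is left abstract so that both schemes are
  covered, and the weight \<open>e\<close> vanishes wherever the bound \<open>S\<close> on
  \<open>\<sigma>\<close> may fail, so the local estimates apply wherever they matter.\<close>

lemma (in prob_space) weak_telescoping:
  fixes v w :: "real \<Rightarrow> real \<Rightarrow> real" and f :: "real \<Rightarrow> real"
    and \<sigma> Y \<xi> :: "nat \<Rightarrow> 'a \<Rightarrow> real" and e :: "'a \<Rightarrow> real"
  assumes step: "\<And>s x b y. \<bar>s\<bar> \<le> S \<Longrightarrow> \<bar>y\<bar> \<le> G \<Longrightarrow>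
      \<bar>v s (x + y * b) - v (s + b) x - w s x * b * (y - f x)\<bar> \<le> K * b\<^sup>2"
    and w_bound: "\<And>s x. \<bar>s\<bar> \<le> S \<Longrightarrow> \<bar>w s x\<bar> \<le> K"
    and v_bound: "\<And>s x. \<bar>v s x\<bar> \<le> C"
    and f_bound: "\<And>x. \<bar>f x\<bar> \<le> G" and "0 \<le> K"
    and meas: "(\<lambda>p. v (fst p) (snd p)) \<in> borel_measurable borel"
      "(\<lambda>p. w (fst p) (snd p)) \<in> borel_measurable borel" "f \<in> borel_measurable borel"
    and \<sigma>: "\<And>n. n \<le> N \<Longrightarrow> \<sigma> n \<in> borel_measurable M"
    and Y: "\<And>n. n \<le> N \<Longrightarrow> Y n \<in> borel_measurable M"
    and \<xi>: "\<And>n. n < N \<Longrightarrow> \<xi> n \<in> borel_measurable M"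
    and \<xi>_bound: "\<And>n \<omega>. n < N \<Longrightarrow> \<bar>\<xi> n \<omega>\<bar> \<le> G"
    and e: "e \<in> borel_measurable M" "\<And>\<omega>. \<bar>e \<omega>\<bar> \<le> 1"
    and \<sigma>_bound: "\<And>n \<omega>. n \<le> N \<Longrightarrow> e \<omega> \<noteq> 0 \<Longrightarrow> \<bar>\<sigma> n \<omega>\<bar> \<le> S"
    and Y_step: "\<And>n \<omega>. n < N \<Longrightarrow> Y (Suc n) \<omega> = Y n \<omega> + \<xi> n \<omega> * (\<sigma> n \<omega> - \<sigma> (Suc n) \<omega>)"
    and square: "\<And>n. n < N \<Longrightarrow> integrable M (\<lambda>\<omega>. (\<sigma> n \<omega> - \<sigma> (Suc n) \<omega>)\<^sup>2)"
    and centred: "\<And>n. n < N \<Longrightarrow> (LINT \<omega>|M. e \<omega> * w (\<sigma> (Suc n) \<omega>) (Y n \<omega>) *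
        (\<sigma> n \<omega> - \<sigma> (Suc n) \<omega>) * (\<xi> n \<omega> - f (Y n \<omega>))) = 0"
  shows "\<bar>(LINT \<omega>|M. e \<omega> * v (\<sigma> N \<omega>) (Y N \<omega>)) - (LINT \<omega>|M. e \<omega> * v (\<sigma> 0 \<omega>) (Y 0 \<omega>))\<bar>
    \<le> K * (\<Sum>n<N. LINT \<omega>|M. (\<sigma> n \<omega> - \<sigma> (Suc n) \<omega>)\<^sup>2)"
proof -
  define V where "V n \<omega> = e \<omega> * v (\<sigma> n \<omega>) (Y n \<omega>)" for n \<omega>
  note [measurable] = e(1) meas(3)
  have v_meas: "(\<lambda>\<omega>. v (s \<omega>) (y \<omega>)) \<in> borel_measurable M"
    and w_meas: "(\<lambda>\<omega>. w (s \<omega>) (y \<omega>)) \<in> borel_measurable M"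
    if "s \<in> borel_measurable M" "y \<in> borel_measurable M" for s y
    using measurable_compose[OF borel_measurable_Pair[OF that] meas(1)]
      measurable_compose[OF borel_measurable_Pair[OF that] meas(2)] by simp_all
  have V_int: "integrable M (V n)" if n: "n \<le> N" for n
  proof (rule integrable_const_bound[of _ C])
    have "\<bar>V n \<omega>\<bar> \<le> 1 * C" for \<omega>
      unfolding V_def abs_mult using e(2) v_bound by (intro mult_mono) auto
    then show "AE \<omega> in M. norm (V n \<omega>) \<le> C" by simp
    show "random_variable borel (V n)"
      unfolding V_def[abs_def] using v_meas[OF \<sigma>[OF n] Y[OF n]] by measurable
  qed
  have one: "\<bar>(LINT \<omega>|M. V (Suc n) \<omega>) - (LINT \<omega>|M. V n \<omega>)\<bar>
      \<le> K * (LINT \<omega>|M. (\<sigma> n \<omega> - \<sigma> (Suc n) \<omega>)\<^sup>2)" if n: "n < N" for n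
  proof -
    let ?b = "\<lambda>\<omega>. \<sigma> n \<omega> - \<sigma> (Suc n) \<omega>"
    define P where "P \<omega> = e \<omega> * w (\<sigma> (Suc n) \<omega>) (Y n \<omega>) * ?b \<omega> * (\<xi> n \<omega> - f (Y n \<omega>))" for \<omega>
    have nN: "n \<le> N" "Suc n \<le> N" using n by auto
    note [measurable] = \<sigma>[OF nN(1)] \<sigma>[OF nN(2)] Y[OF nN(1)] \<xi>[OF n]
      w_meas[OF \<sigma>[OF nN(2)] Y[OF nN(1)]]
    \<comment> \<open>The bounding constant carries an absolute value because
      \<open>0 \<le> S\<close> is available only at points with
      \<open>e \<omega> \<noteq> 0\<close>.\<close>
    have P_int: "integrable M P"
    proof (rule integrable_const_bound[of _ "\<bar>1 * K * (2 * S) * (2 * G)\<bar>"])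
      have "\<bar>P \<omega>\<bar> \<le> 1 * K * (2 * S) * (2 * G)" if "e \<omega> \<noteq> 0" for \<omega>
      proof -
        have s: "\<bar>\<sigma> n \<omega>\<bar> \<le> S" "\<bar>\<sigma> (Suc n) \<omega>\<bar> \<le> S" using \<sigma>_bound that nN by auto
        then have "\<bar>?b \<omega>\<bar> \<le> 2 * S" by linarith
        moreover have "\<bar>\<xi> n \<omega> - f (Y n \<omega>)\<bar> \<le> 2 * G"
          using \<xi>_bound[OF n, of \<omega>] f_bound[of "Y n \<omega>"] by linarith
        moreover have "\<bar>w (\<sigma> (Suc n) \<omega>) (Y n \<omega>)\<bar> \<le> K" by (rule w_bound[OF s(2)])
        moreover have "0 \<le> S" using s by linarith
        ultimately show ?thesis
          unfolding P_def abs_mult using e(2) \<open>0 \<le> K\<close> by (intro mult_mono) auto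
      qed
      moreover have "\<bar>P \<omega>\<bar> \<le> \<bar>1 * K * (2 * S) * (2 * G)\<bar>" if "e \<omega> = 0" for \<omega>
        using that by (simp add: P_def)
      ultimately show "AE \<omega> in M. norm (P \<omega>) \<le> \<bar>1 * K * (2 * S) * (2 * G)\<bar>"
        by (intro AE_I2) (metis abs_ge_self order_trans real_norm_def)
      show "random_variable borel P" unfolding P_def[abs_def] by measurable
    qed
    \<comment> \<open>The first-order term \<open>P\<close> has mean 0 by \<open>centred\<close>, so
      subtracting it is free and leaves only a quadratic remainder.\<close>
    have "(LINT \<omega>|M. V (Suc n) \<omega>) - (LINT \<omega>|M. V n \<omega>) = (LINT \<omega>|M. V (Suc n) \<omega> - V n \<omega> - P \<omega>)"
      using V_int nN P_int centred[OF n] by (simp add: P_def[abs_def])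
    also have "\<bar>\<dots>\<bar> \<le> (LINT \<omega>|M. \<bar>V (Suc n) \<omega> - V n \<omega> - P \<omega>\<bar>)"
      by (rule integral_abs_bound)
    also have "\<dots> \<le> (LINT \<omega>|M. K * (?b \<omega>)\<^sup>2)"
    proof (rule integral_mono)
      show "integrable M (\<lambda>\<omega>. \<bar>V (Suc n) \<omega> - V n \<omega> - P \<omega>\<bar>)"
        using V_int nN P_int by auto
      show "integrable M (\<lambda>\<omega>. K * (?b \<omega>)\<^sup>2)" using square[OF n] by simp
      show "\<bar>V (Suc n) \<omega> - V n \<omega> - P \<omega>\<bar> \<le> K * (?b \<omega>)\<^sup>2" for \<omega>
      proof (cases "e \<omega> = 0")
        case True
        then show ?thesis
          using \<open>0 \<le> K\<close> by (simp add: V_def P_def)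
      next
        case False
        \<comment> \<open>This is \<open>step\<close> at
          \<open>s = \<sigma> (Suc n) \<omega>\<close> with \<open>b = ?b \<omega>\<close>: then
          \<open>s + b\<close> is \<open>\<sigma> n \<omega>\<close>, and
          \<open>Y n \<omega> + \<xi> n \<omega> * b\<close> is the next value of
          \<open>Y\<close>.\<close>
        let ?r = "v (\<sigma> (Suc n) \<omega>) (Y n \<omega> + \<xi> n \<omega> * ?b \<omega>) - v (\<sigma> (Suc n) \<omega> + ?b \<omega>) (Y n \<omega>)
            - w (\<sigma> (Suc n) \<omega>) (Y n \<omega>) * ?b \<omega> * (\<xi> n \<omega> - f (Y n \<omega>))"
        have "V (Suc n) \<omega> - V n \<omega> - P \<omega> = e \<omega> * ?r"
          by (simp add: V_def P_def Y_step[OF n] algebra_simps)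
        moreover have "\<bar>e \<omega> * ?r\<bar> \<le> 1 * (K * (?b \<omega>)\<^sup>2)"
          unfolding abs_mult
          by (rule mult_mono[OF e(2) step[OF \<sigma>_bound[OF nN(2) False] \<xi>_bound[OF n]]]) auto
        ultimately show ?thesis by simp
      qed
    qed
    finally show ?thesis by simp
  qed
  have "n \<le> N \<Longrightarrow> \<bar>(LINT \<omega>|M. V n \<omega>) - (LINT \<omega>|M. V 0 \<omega>)\<bar>
      \<le> K * (\<Sum>k<n. LINT \<omega>|M. (\<sigma> k \<omega> - \<sigma> (Suc k) \<omega>)\<^sup>2)" for n
  proof (induction n)
    case (Suc n)
    then show ?case using one[of n] by (simp add: distrib_left)
  qed simp
  then show ?thesis by (simp add: V_def)
qed

section \<open>Measurability of the two schemes\<close>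

lemma auxiliary_scheme_measurable:
  assumes "0 \<le> dt" and [measurable]: "averaged g \<in> borel_measurable borel"
  shows "auxiliary_scheme g x0 \<beta> dt n \<in> borel_measurable (process_sigma M \<beta>)"
proof (induction n)
  case (Suc n)
  have t: "0 \<le> real (Suc n) * dt" "0 \<le> real n * dt" using assms(1) by auto
  note [measurable] = Suc process_measurable[OF t(1), of \<beta> M] process_measurable[OF t(2), of \<beta> M]
  show ?case unfolding auxiliary_scheme.simps by measurable
qed simp

text \<open>The first \<open>n\<close> steps use only the noise variables with index below
  \<open>n\<close>, so the value at step \<open>n\<close> belongs to the past of noise variable
  \<open>n\<close>. A fixed \<open>N\<close> keeps the sigma-algebra constant during the
  induction.\<close>

lemma limiting_scheme_measurable:
  fixes g :: "real \<times> real \<Rightarrow> real"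
  assumes "0 \<le> dt" and g[measurable]: "g \<in> borel_measurable borel" and "n \<le> N"
  shows "limiting_scheme g x0 \<beta> B dt n \<in> borel_measurable (past_sigma M \<beta> B dt N)"
  using \<open>n \<le> N\<close>
proof (induction n)
  case (Suc n)
  then have IH: "limiting_scheme g x0 \<beta> B dt n \<in> borel_measurable (past_sigma M \<beta> B dt N)"
    and n: "n < N" by auto
  have t: "0 \<le> real (Suc n) * dt" "0 \<le> real n * dt" using assms(1) by auto
  note [measurable] = IH scaled_increment_past_measurable[OF n, of B dt M \<beta>]
    measurable_past_sigma_process[THEN subsetD, OF process_measurable[OF t(1), of \<beta> M]]
    measurable_past_sigma_process[THEN subsetD, OF process_measurable[OF t(2), of \<beta> M]]
  show ?case
    unfolding limiting_scheme.simps
    using measurable_compose[OF borel_measurable_Pair[OF IH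
        scaled_increment_past_measurable[OF n, of B dt M \<beta>]] g]
    by measurable
qed simp

text \<open>The absolute error is a pairing with a sign measurable in \<open>\<beta>\<close>, under
  which the conditional expectation may be replaced by the payoff itself. On \<open>A\<close> each
  scheme contributes one telescoping error, hence the factor 2 before \<open>K\<close>; off
  \<open>A\<close> the payoffs differ by at most \<open>2 * C\<close>.\<close>

lemma scheme_error_bound:
  fixes M :: "'a measure" and g :: "real \<times> real \<Rightarrow> real"
  assumes "prob_space M"
    and \<beta>: "fractional_brownian_motion M H \<beta>" and B: "brownian_motion M B"
    and indep: "indep_processes M B \<beta>" and T: "0 < T" and N: "0 < N"
    and g: "g \<in> borel_measurable borel" "\<And>p. \<bar>g p\<bar> \<le> G"
    and avg: "averaged g \<in> borel_measurable borel"
    and \<phi>: "\<phi> \<in> borel_measurable borel" "\<And>x. \<bar>\<phi> x\<bar> \<le> C"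
    and v0: "\<And>x. v 0 x = \<phi> x" and v_range: "\<And>s x. v s x \<in> range \<phi>"
    and w_bound: "\<And>s x. \<bar>s\<bar> \<le> S \<Longrightarrow> \<bar>w s x\<bar> \<le> K"
    and step: "\<And>s x b y. \<bar>s\<bar> \<le> S \<Longrightarrow> \<bar>y\<bar> \<le> G \<Longrightarrow>
      \<bar>v s (x + y * b) - v (s + b) x - w s x * b * (y - averaged g x)\<bar> \<le> K * b\<^sup>2"
    and meas: "(\<lambda>p. v (fst p) (snd p)) \<in> borel_measurable borel"
      "(\<lambda>p. w (fst p) (snd p)) \<in> borel_measurable borel"
    and S: "0 \<le> S"
    and A: "A \<in> sets (process_sigma M \<beta>)"
    and A_bound: "\<And>\<omega> n. \<omega> \<in> A \<Longrightarrow> n \<le> N \<Longrightarrow> \<bar>\<beta> T \<omega> - \<beta> (real n * (T / real N)) \<omega>\<bar> \<le> S"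
  shows "(LINT \<omega>|M. \<bar>real_cond_exp M (process_sigma M \<beta>)
      (\<lambda>\<omega>'. \<phi> (limiting_scheme g x0 \<beta> B (T / real N) N \<omega>')) \<omega>
      - \<phi> (auxiliary_scheme g x0 \<beta> (T / real N) N \<omega>)\<bar>)
    \<le> 2 * K * (real N * (T / real N) powr (2 * H)) + 2 * C * measure M (space M - A)"
proof -
  interpret prob_space M by fact
  define dt where "dt = T / real N"
  have dt: "0 < dt" and NT: "real N * dt = T" using T N by (auto simp: dt_def)
  let ?F = "process_sigma M \<beta>" and ?P = "past_sigma M \<beta> B dt"
  define X where "X = limiting_scheme g x0 \<beta> B dt"
  define Xb where "Xb = auxiliary_scheme g x0 \<beta> dt"
  define \<gamma> where "\<gamma> = scaled_increment B dt"
  \<comment> \<open>The increment of \<open>\<beta>\<close> still to come, which is the flow time.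
    It is 0 at \<open>n = N\<close> because \<open>real N * dt = T\<close>, and there
    \<open>v\<close> equals the payoff.\<close>
  define \<sigma> where "\<sigma> n \<omega> = \<beta> T \<omega> - \<beta> (real n * dt) \<omega>" for n \<omega>
  have sub: "subalgebra M ?F"
    by (rule subalgebra_process_sigma) (rule fbm_measurable(1)[OF \<beta>])
  interpret F: finite_measure_subalgebra M ?F
    by unfold_locales (rule sub)
  have B_meas: "\<And>t. 0 \<le> t \<Longrightarrow> B t \<in> borel_measurable M"
    using B by (simp add: brownian_motion_def)
  have \<gamma>_meas: "\<gamma> k \<in> borel_measurable M" for k
    unfolding \<gamma>_def by (rule scaled_increment_measurable[OF B_meas dt])
  have subP: "subalgebra M (?P n)" for n
    by (rule subalgebra_past_sigma[OF sub]) (use \<gamma>_meas in \<open>simp add: \<gamma>_def\<close>)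
  have F_to_P: "h \<in> borel_measurable (?P n)" if "h \<in> borel_measurable ?F" for h :: "'a \<Rightarrow> real" and n
    using measurable_past_sigma_process that by blast
  have F_to_M: "h \<in> borel_measurable M" if "h \<in> borel_measurable ?F" for h :: "'a \<Rightarrow> real"
    by (rule measurable_from_subalg[OF sub that])
  have \<sigma>_F: "\<sigma> n \<in> borel_measurable ?F" for n
    unfolding \<sigma>_def[abs_def]
    using process_measurable[of T \<beta> M] process_measurable[of "real n * dt" \<beta> M] T dt by simp
  have X_P: "X n \<in> borel_measurable (?P m)" if "n \<le> m" for n m
    unfolding X_def using dt g(1) that by (intro limiting_scheme_measurable) auto
  have X_M: "X n \<in> borel_measurable M" for n
    by (rule measurable_from_subalg[OF subP X_P[OF order_refl]])
  have Xb_F: "Xb n \<in> borel_measurable ?F" for n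
    unfolding Xb_def using dt avg by (intro auxiliary_scheme_measurable) auto
  have avg_bound: "\<bar>averaged g x\<bar> \<le> G" for x
    unfolding averaged_def by (rule std_normal_average_le[OF g(2)])
  have v_bound: "\<bar>v s x\<bar> \<le> C" for s x
    using v_range[of s x] \<phi>(2) by auto
  have K: "0 \<le> K" using w_bound[of 0 0] S by simp
  have \<sigma>_diff: "\<sigma> n \<omega> - \<sigma> (Suc n) \<omega> = \<beta> (real (Suc n) * dt) \<omega> - \<beta> (real n * dt) \<omega>" for n \<omega>
    by (simp add: \<sigma>_def)
  have square: "integrable M (\<lambda>\<omega>. (\<sigma> n \<omega> - \<sigma> (Suc n) \<omega>)\<^sup>2)"
    and variance: "(LINT \<omega>|M. (\<sigma> n \<omega> - \<sigma> (Suc n) \<omega>)\<^sup>2) = dt powr (2 * H)" for n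
  proof -
    have t: "0 \<le> real n * dt" "0 \<le> real (Suc n) * dt" using dt by auto
    have "\<bar>real (Suc n) * dt - real n * dt\<bar> = dt" using dt by (simp add: algebra_simps)
    with fbm_increment_variance[OF assms(1) \<beta> t]
    show "integrable M (\<lambda>\<omega>. (\<sigma> n \<omega> - \<sigma> (Suc n) \<omega>)\<^sup>2)"
      "(LINT \<omega>|M. (\<sigma> n \<omega> - \<sigma> (Suc n) \<omega>)\<^sup>2) = dt powr (2 * H)"
      unfolding \<sigma>_diff by simp_all
  qed
  have w_meas: "(\<lambda>\<omega>. w (s \<omega>) (y \<omega>)) \<in> borel_measurable R"
    if "s \<in> borel_measurable R" "y \<in> borel_measurable R" for s y and R :: "'a measure"
    using measurable_compose[OF borel_measurable_Pair[OF that] meas(2)] by simp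
  define Z W where "Z \<omega> = \<phi> (X N \<omega>)" and "W \<omega> = \<phi> (Xb N \<omega>)" for \<omega>
  have Z_meas: "Z \<in> borel_measurable M"
    unfolding Z_def[abs_def] by (rule measurable_compose[OF X_M \<phi>(1)])
  have W_F: "W \<in> borel_measurable ?F"
    unfolding W_def[abs_def] by (rule measurable_compose[OF Xb_F \<phi>(1)])
  define ce where "ce = real_cond_exp M ?F Z"
  have ce_F: "ce \<in> borel_measurable ?F" unfolding ce_def by simp
  define \<epsilon> where "\<epsilon> \<omega> = sgn (ce \<omega> - W \<omega>)" for \<omega>
  define e where "e \<omega> = \<epsilon> \<omega> * indicator A \<omega>" for \<omega>
  have \<epsilon>_F: "\<epsilon> \<in> borel_measurable ?F"
    unfolding \<epsilon>_def[abs_def] using ce_F W_F by simp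
  have e_F: "e \<in> borel_measurable ?F"
    unfolding e_def[abs_def] using \<epsilon>_F A by simp
  have \<epsilon>_le: "\<bar>\<epsilon> \<omega>\<bar> \<le> 1" and e_le: "\<bar>e \<omega>\<bar> \<le> 1" for \<omega>
    by (auto simp: \<epsilon>_def e_def sgn_if indicator_def)
  have \<sigma>_bound: "\<bar>\<sigma> n \<omega>\<bar> \<le> S" if "n \<le> N" "e \<omega> \<noteq> 0" for n \<omega>
    using that A_bound by (auto simp: e_def \<sigma>_def dt_def indicator_def split: if_splits)
  have X_step: "X (Suc n) \<omega> = X n \<omega> + g (X n \<omega>, \<gamma> n \<omega>) * (\<sigma> n \<omega> - \<sigma> (Suc n) \<omega>)" for n \<omega>
    by (simp add: X_def \<gamma>_def \<sigma>_diff del: of_nat_Suc)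
  have Xb_step: "Xb (Suc n) \<omega> = Xb n \<omega> + averaged g (Xb n \<omega>) * (\<sigma> n \<omega> - \<sigma> (Suc n) \<omega>)" for n \<omega>
    by (simp add: Xb_def \<sigma>_diff del: of_nat_Suc)
  define Q where "Q = real N * dt powr (2 * H)"
  have Q: "(\<Sum>n<N. LINT \<omega>|M. (\<sigma> n \<omega> - \<sigma> (Suc n) \<omega>)\<^sup>2) = Q"
    by (simp add: variance Q_def)
  have "\<bar>(LINT \<omega>|M. e \<omega> * v (\<sigma> N \<omega>) (X N \<omega>)) - (LINT \<omega>|M. e \<omega> * v (\<sigma> 0 \<omega>) (X 0 \<omega>))\<bar> \<le> K * Q"
    unfolding Q[symmetric]
  proof (rule weak_telescoping[where S = S and G = G and w = w and C = C and f = "averaged g"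
        and \<sigma> = \<sigma> and Y = X and e = e and N = N and \<xi> = "\<lambda>n \<omega>. g (X n \<omega>, \<gamma> n \<omega>)"])
    \<comment> \<open>The factors \<open>e\<close> and \<open>\<sigma>\<close> look at the whole
      path of \<open>\<beta>\<close>, including its future. They are still measurable for
      \<open>?P n\<close>, which contains all events of \<open>\<beta>\<close> and is independent of
      \<open>\<gamma> n\<close>.\<close>
    show "(LINT \<omega>|M. e \<omega> * w (\<sigma> (Suc n) \<omega>) (X n \<omega>) * (\<sigma> n \<omega> - \<sigma> (Suc n) \<omega>) *
        (g (X n \<omega>, \<gamma> n \<omega>) - averaged g (X n \<omega>))) = 0" if n: "n < N" for n
    proof (rule indep_average_zero[OF subP[of n], where c = "1 * K * (2 * S)" and G = G
          and U = "\<lambda>\<omega>. e \<omega> * w (\<sigma> (Suc n) \<omega>) (X n \<omega>) * (\<sigma> n \<omega> - \<sigma> (Suc n) \<omega>)"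
          and X = "X n" and \<gamma> = "\<gamma> n"])
      show "(\<lambda>\<omega>. e \<omega> * w (\<sigma> (Suc n) \<omega>) (X n \<omega>) * (\<sigma> n \<omega> - \<sigma> (Suc n) \<omega>)) \<in> borel_measurable (?P n)"
        using F_to_P[OF e_F] F_to_P[OF \<sigma>_F] w_meas[OF F_to_P[OF \<sigma>_F] X_P[OF order_refl]]
        by (intro borel_measurable_times borel_measurable_diff)
      show "X n \<in> borel_measurable (?P n)" by (rule X_P) simp
      show "\<gamma> n \<in> borel_measurable M" by (rule \<gamma>_meas)
      show "indep_set (sets (?P n)) {\<gamma> n -` A \<inter> space M | A. A \<in> sets borel}"
        unfolding \<gamma>_def by (rule past_sigma_indep_increment[OF assms(1) B indep dt])
      show "distr M borel (\<gamma> n) = std_normal_measure"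
        unfolding \<gamma>_def by (rule scaled_increment_distr[OF assms(1) B dt])
      show "\<bar>e \<omega> * w (\<sigma> (Suc n) \<omega>) (X n \<omega>) * (\<sigma> n \<omega> - \<sigma> (Suc n) \<omega>)\<bar> \<le> 1 * K * (2 * S)" for \<omega>
      proof (cases "e \<omega> = 0")
        case True
        then show ?thesis using K S by simp
      next
        case False
        have s: "\<bar>\<sigma> n \<omega>\<bar> \<le> S" "\<bar>\<sigma> (Suc n) \<omega>\<bar> \<le> S"
          using \<sigma>_bound[OF _ False] n by auto
        then have "\<bar>\<sigma> n \<omega> - \<sigma> (Suc n) \<omega>\<bar> \<le> 2 * S" by linarith
        then show ?thesis
          unfolding abs_mult using e_le w_bound[OF s(2)] K S by (intro mult_mono) auto
      qed
    qed (use g in auto)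
    show "(\<lambda>\<omega>. g (X n \<omega>, \<gamma> n \<omega>)) \<in> borel_measurable M" for n
      using measurable_compose[OF borel_measurable_Pair[OF X_M \<gamma>_meas] g(1)] .
  qed (use step w_bound v_bound avg_bound K meas avg F_to_M[OF \<sigma>_F] X_M g(2) F_to_M[OF e_F] e_le
      \<sigma>_bound X_step square in blast)+
  moreover have "\<bar>(LINT \<omega>|M. e \<omega> * v (\<sigma> N \<omega>) (Xb N \<omega>))
      - (LINT \<omega>|M. e \<omega> * v (\<sigma> 0 \<omega>) (Xb 0 \<omega>))\<bar> \<le> K * Q"
    unfolding Q[symmetric]
  proof (rule weak_telescoping[where S = S and G = G and w = w and C = C and f = "averaged g"
        and \<sigma> = \<sigma> and Y = Xb and e = e and N = N and \<xi> = "\<lambda>n \<omega>. averaged g (Xb n \<omega>)"])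
    \<comment> \<open>For the auxiliary scheme the slope is the averaged coefficient itself, so the
      first-order term is identically 0.\<close>
    show "(LINT \<omega>|M. e \<omega> * w (\<sigma> (Suc n) \<omega>) (Xb n \<omega>) * (\<sigma> n \<omega> - \<sigma> (Suc n) \<omega>) *
        (averaged g (Xb n \<omega>) - averaged g (Xb n \<omega>))) = 0" for n
      by simp
    show "(\<lambda>\<omega>. averaged g (Xb n \<omega>)) \<in> borel_measurable M" for n
      by (rule measurable_compose[OF F_to_M[OF Xb_F] avg])
  qed (use step w_bound v_bound avg_bound K meas avg F_to_M[OF \<sigma>_F] F_to_M[OF Xb_F]
      F_to_M[OF e_F] e_le \<sigma>_bound Xb_step square in blast)+
  \<comment> \<open>Both telescopes start from the same value and end at the payoff, so their bounds
    can be added.\<close>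
  moreover have "X 0 \<omega> = Xb 0 \<omega>" "v (\<sigma> N \<omega>) x = \<phi> x" for \<omega> x
    by (simp_all add: X_def Xb_def \<sigma>_def NT v0)
  ultimately have main: "(LINT \<omega>|M. e \<omega> * Z \<omega>) - (LINT \<omega>|M. e \<omega> * W \<omega>) \<le> 2 * (K * Q)"
    by (simp add: Z_def W_def)
  have W_meas: "W \<in> borel_measurable M" by (rule F_to_M[OF W_F])
  have bounded_int: "integrable M (\<lambda>\<omega>. h \<omega> * y \<omega>)"
    if "h \<in> borel_measurable M" "\<And>\<omega>. \<bar>h \<omega>\<bar> \<le> 1" "y \<in> borel_measurable M" "\<And>\<omega>. \<bar>y \<omega>\<bar> \<le> C"
    for h y :: "'a \<Rightarrow> real"
  proof (rule integrable_const_bound[of _ "1 * C"])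
    show "AE \<omega> in M. norm (h \<omega> * y \<omega>) \<le> 1 * C"
      unfolding real_norm_def abs_mult
      by (intro AE_I2 mult_mono that) (use that(2) in auto)
  qed (use that in simp)
  have Z_le: "\<bar>Z \<omega>\<bar> \<le> C" and W_le: "\<bar>W \<omega>\<bar> \<le> C" for \<omega>
    using \<phi>(2) by (simp_all add: Z_def W_def)
  note ints = bounded_int[OF F_to_M[OF \<epsilon>_F] \<epsilon>_le Z_meas Z_le]
    bounded_int[OF F_to_M[OF \<epsilon>_F] \<epsilon>_le W_meas W_le]
    bounded_int[OF F_to_M[OF e_F] e_le Z_meas Z_le]
    bounded_int[OF F_to_M[OF e_F] e_le W_meas W_le]
  have A_M: "A \<in> sets M" using A sub by (auto simp: subalgebra_def)
  have ind_int: "integrable M (\<lambda>\<omega>. indicat_real (space M - A) \<omega>)"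
    using A_M by (intro integrable_real_indicator) (auto simp: emeasure_eq_measure)
  \<comment> \<open>The defining property of conditional expectation against the weight
    \<open>\<epsilon>\<close>, measurable in \<open>?F\<close>: it exchanges \<open>ce\<close> for
    \<open>Z\<close> under the integral.\<close>
  note intg = F.real_cond_exp_intg[OF ints(1) \<epsilon>_F Z_meas, folded ce_def]
  have "(LINT \<omega>|M. \<bar>ce \<omega> - W \<omega>\<bar>) = (LINT \<omega>|M. \<epsilon> \<omega> * ce \<omega> - \<epsilon> \<omega> * W \<omega>)"
    by (intro Bochner_Integration.integral_cong refl)
      (simp add: \<epsilon>_def abs_sgn algebra_simps)
  also have "\<dots> = (LINT \<omega>|M. \<epsilon> \<omega> * Z \<omega> - \<epsilon> \<omega> * W \<omega>)"
    using intg ints by simp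
  also have "\<dots> \<le> (LINT \<omega>|M. (e \<omega> * Z \<omega> - e \<omega> * W \<omega>) + 2 * C * indicator (space M - A) \<omega>)"
  proof (rule integral_mono)
    show "integrable M (\<lambda>\<omega>. (e \<omega> * Z \<omega> - e \<omega> * W \<omega>) + 2 * C * indicator (space M - A) \<omega>)"
      by (intro Bochner_Integration.integrable_add Bochner_Integration.integrable_diff
          integrable_mult_right ints ind_int)
    show "integrable M (\<lambda>\<omega>. \<epsilon> \<omega> * Z \<omega> - \<epsilon> \<omega> * W \<omega>)" using ints by simp
    fix \<omega> assume \<omega>: "\<omega> \<in> space M"
    show "\<epsilon> \<omega> * Z \<omega> - \<epsilon> \<omega> * W \<omega>
        \<le> (e \<omega> * Z \<omega> - e \<omega> * W \<omega>) + 2 * C * indicator (space M - A) \<omega>"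
    proof (cases "\<omega> \<in> A")
      case True
      then show ?thesis by (simp add: e_def)
    next
      case False
      have "\<bar>\<epsilon> \<omega> * (Z \<omega> - W \<omega>)\<bar> \<le> 1 * (2 * C)"
        unfolding abs_mult using \<epsilon>_le Z_le[of \<omega>] W_le[of \<omega>] by (intro mult_mono) auto
      with False \<omega> show ?thesis by (simp add: e_def right_diff_distrib)
    qed
  qed
  also have "\<dots> = (LINT \<omega>|M. e \<omega> * Z \<omega>) - (LINT \<omega>|M. e \<omega> * W \<omega>) + 2 * C * measure M (space M - A)"
    using A_M ind_int ints by (simp del: prob_compl)
  also have "\<dots> \<le> 2 * (K * Q) + 2 * C * measure M (space M - A)"
    using main by simp
  finally show ?thesis
    by (simp add: ce_def Z_def[abs_def] W_def X_def Xb_def Q_def dt_def mult.assoc)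
qed

text \<open>The sequence equals \<open>T powr (2 * H) * real N powr (1 - 2 * H)\<close>, whose
  exponent in \<open>N\<close> is negative exactly when \<open>H\<close> exceeds 1/2.\<close>

lemma mesh_variance_tendsto_0:
  fixes H T :: real
  assumes "1 / 2 < H" "0 < T"
  shows "(\<lambda>N. real N * (T / real N) powr (2 * H)) \<longlonglongrightarrow> 0"
proof -
  have "(\<lambda>N. T powr (2 * H) * real N powr (1 - 2 * H)) \<longlonglongrightarrow> 0"
    using assms
    by (intro tendsto_mult_right_zero tendsto_neg_powr filterlim_real_sequentially) auto
  moreover have "\<forall>\<^sub>F N in sequentially.
      T powr (2 * H) * real N powr (1 - 2 * H) = real N * (T / real N) powr (2 * H)"
    using eventually_gt_at_top[of 0]
  proof eventually_elim
    case (elim N)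
    then show ?case using assms by (simp add: powr_divide powr_diff)
  qed
  ultimately show ?thesis by (rule Lim_transform_eventually)
qed

theorem proposition2p3:
  fixes M :: "'a measure"
    and H x0 T :: real
    and \<beta> B :: "real \<Rightarrow> 'a \<Rightarrow> real"
    and g :: "real \<times> real \<Rightarrow> real"
    and \<phi> :: "real \<Rightarrow> real"
  assumes "prob_space M"
    and "1 / 2 < H" and "H < 1"
    and "fractional_brownian_motion M H \<beta>"
    and "brownian_motion M B"
    and "indep_processes M B \<beta>"
    and "Cb 3 g"
    and "0 < T"
    and "Cb 3 \<phi>"
  shows "(\<lambda>N. LINT \<omega>|M.
           \<bar>real_cond_exp M (process_sigma M \<beta>)
              (\<lambda>\<omega>'. \<phi> (limiting_scheme g x0 \<beta> B (T / real N) N \<omega>')) \<omega>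
            - \<phi> (auxiliary_scheme g x0 \<beta> (T / real N) N \<omega>)\<bar>)
         \<longlonglongrightarrow> 0"
proof -
  interpret prob_space M by fact
  let ?F = "process_sigma M \<beta>"
  obtain G where G: "\<And>p. \<bar>g p\<bar> \<le> G"
    using Cb_bounded[OF assms(7)] by blast
  from averaged_scalar_field[OF assms(7) G] obtain f1 L L2
    where sf: "scalar_field (averaged g) f1 G L L2" by blast
  have avg: "averaged g \<in> borel_measurable borel"
    by (intro borel_measurable_continuous_onI DERIV_continuous_on[OF scalar_field.f_deriv[OF sf]])
  have \<phi>': "Cb (Suc (Suc 1)) \<phi>"
    using assms(9) by (simp only: numeral_3_eq_3 One_nat_def)
  then have \<phi>_der: "(\<phi> has_real_derivative deriv \<phi> x) (at x)"
    and \<phi>1_der: "(deriv \<phi> has_real_derivative deriv (deriv \<phi>) x) (at x)" for x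
    unfolding Cb_Suc_real DERIV_deriv_iff_field_differentiable by blast+
  have "Cb 2 (deriv \<phi>)" "Cb 1 (deriv (deriv \<phi>))"
    using \<phi>' unfolding Cb_Suc_real by (auto simp only: Cb_Suc_real Suc_1[symmetric])
  then obtain C1 C2 where C1: "\<And>x. \<bar>deriv \<phi> x\<bar> \<le> C1" and C2: "\<And>x. \<bar>deriv (deriv \<phi>) x\<bar> \<le> C2"
    using Cb_bounded by metis
  obtain C where C: "\<And>x. \<bar>\<phi> x\<bar> \<le> C"
    using Cb_bounded[OF assms(9)] by blast
  obtain v w K where vw: "\<And>x. v 0 x = \<phi> x" "\<And>s x. v s x \<in> range \<phi>"
    "\<And>s x S. \<bar>s\<bar> \<le> S \<Longrightarrow> \<bar>w s x\<bar> \<le> K S"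
    "\<And>s x b \<xi> S. \<bar>s\<bar> \<le> S \<Longrightarrow> \<bar>\<xi>\<bar> \<le> G \<Longrightarrow>
      \<bar>v s (x + \<xi> * b) - v (s + b) x - w s x * b * (\<xi> - averaged g x)\<bar> \<le> K S * b\<^sup>2"
    "(\<lambda>p. v (fst p) (snd p)) \<in> borel_measurable borel"
    "(\<lambda>p. w (fst p) (snd p)) \<in> borel_measurable borel"
    by (rule scalar_field.transported_payoff[OF sf \<phi>_der C1
          lipschitz_of_bounded_deriv[OF \<phi>1_der C2]]) blast
  have g_meas: "g \<in> borel_measurable borel" and \<phi>_meas: "\<phi> \<in> borel_measurable borel"
    using assms(7,9) by (auto intro: borel_measurable_continuous_onI Cb_continuous)
  have sub: "subalgebra M ?F"
    by (rule subalgebra_process_sigma) (rule fbm_measurable(1)[OF assms(4)])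
  \<comment> \<open>Rational fractions of \<open>T\<close> make this a countable intersection, hence
    an event of \<open>\<beta>\<close>, and they contain the grid points \<open>n / N\<close> for
    every \<open>N\<close>. One event thus controls all meshes.\<close>
  define A where "A m = (\<Inter>q\<in>\<rat> \<inter> {0..1}. {\<omega> \<in> space M. \<bar>\<beta> T \<omega> - \<beta> (q * T) \<omega>\<bar> \<le> real m})" for m :: nat
  have A_F: "A m \<in> sets ?F" for m
  proof -
    have "{\<omega> \<in> space M. \<bar>\<beta> T \<omega> - \<beta> (q * T) \<omega>\<bar> \<le> real m} \<in> sets ?F" if "q \<in> \<rat> \<inter> {0..1}" for q
    proof -
      have "0 \<le> q * T" using assms(8) that by simp
      note [measurable] = process_measurable[OF this, of \<beta> M]
        process_measurable[of T \<beta> M, OF less_imp_le[OF assms(8)]]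
      have "{\<omega> \<in> space ?F. \<bar>\<beta> T \<omega> - \<beta> (q * T) \<omega>\<bar> \<le> real m} \<in> sets ?F" by measurable
      then show ?thesis by (simp add: space_process_sigma)
    qed
    moreover have "(0::real) \<in> \<rat> \<inter> {0..1}" by simp
    moreover have "countable (\<rat> \<inter> {0..1::real})" by (simp add: countable_rat)
    ultimately show ?thesis
      unfolding A_def by (intro sets.countable_INT') blast+
  qed
  have A_M: "A m \<in> sets M" for m
    using A_F sub by (auto simp: subalgebra_def)
  \<comment> \<open>Almost every path is continuous, hence bounded on \<open>{0..T}\<close>, so it
    lies in \<open>A m\<close> once \<open>m\<close> is at least twice that bound.\<close>
  have A_lim: "(\<lambda>m. measure M (space M - A m)) \<longlonglongrightarrow> 0"
  proof -
    have "(\<lambda>m. measure M (space M - A m)) \<longlonglongrightarrow> measure M (\<Inter>m. space M - A m)"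
    proof (rule finite_Lim_measure_decseq)
      show "range (\<lambda>m. space M - A m) \<subseteq> sets M" using A_M by auto
      show "decseq (\<lambda>m. space M - A m)"
      proof (intro decseq_SucI Diff_mono order_refl)
        show "A m \<subseteq> A (Suc m)" for m
          unfolding A_def by (intro INF_mono') auto
      qed
    qed
    moreover have "measure M (\<Inter>m. space M - A m) = 0"
    proof (subst prob_eq_0)
      show "(\<Inter>m. space M - A m) \<in> sets M" using A_M by auto
      have "AE \<omega> in M. continuous_on {0..} (\<lambda>t. \<beta> t \<omega>)"
        using assms(4) by (simp add: fractional_brownian_motion_def)
      then show "AE \<omega> in M. \<omega> \<notin> (\<Inter>m. space M - A m)"
      proof eventually_elim
        case (elim \<omega>)
        have "compact ((\<lambda>t. \<beta> t \<omega>) ` {0..T})"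
          by (intro compact_continuous_image continuous_on_subset[OF elim]) auto
        then obtain R where R: "\<And>t. 0 \<le> t \<Longrightarrow> t \<le> T \<Longrightarrow> \<bar>\<beta> t \<omega>\<bar> \<le> R"
          using compact_imp_bounded by (fastforce simp: bounded_iff)
        obtain m where m: "2 * R \<le> real m" using real_arch_simple by blast
        have "\<bar>\<beta> T \<omega> - \<beta> (q * T) \<omega>\<bar> \<le> real m" if "0 \<le> q" "q \<le> 1" for q
        proof -
          have "\<bar>\<beta> T \<omega>\<bar> \<le> R" "\<bar>\<beta> (q * T) \<omega>\<bar> \<le> R"
            using R[of T] R[of "q * T"] that assms(8) by (auto simp: mult_left_le_one_le)
          with m show ?thesis by linarith
        qed
        then show ?case
          by (auto simp: A_def intro!: exI[of _ m])
      qed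
    qed
    ultimately show ?thesis by simp
  qed
  let ?E = "\<lambda>N. LINT \<omega>|M. \<bar>real_cond_exp M ?F
      (\<lambda>\<omega>'. \<phi> (limiting_scheme g x0 \<beta> B (T / real N) N \<omega>')) \<omega>
      - \<phi> (auxiliary_scheme g x0 \<beta> (T / real N) N \<omega>)\<bar>"
  have bound: "?E N \<le> 2 * K (real m) * (real N * (T / real N) powr (2 * H))
      + 2 * C * measure M (space M - A m)" if "0 < N" for N m
  proof (rule scheme_error_bound[OF assms(1,4-6,8) that g_meas G avg \<phi>_meas C vw(1,2) _ _ vw(5,6) _ A_F])
    fix \<omega> n assume \<omega>: "\<omega> \<in> A m" and n: "n \<le> N"
    have "real n / real N \<in> \<rat> \<inter> {0..1}" using n that by (simp add: divide_le_eq)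
    with \<omega> have "\<bar>\<beta> T \<omega> - \<beta> (real n / real N * T) \<omega>\<bar> \<le> real m"
      unfolding A_def by blast
    then show "\<bar>\<beta> T \<omega> - \<beta> (real n * (T / real N)) \<omega>\<bar> \<le> real m" by simp
  qed (use vw(3,4) in auto)
  show ?thesis
  proof (rule tendstoI)
    fix r :: real assume "0 < r"
    have "(\<lambda>m. 2 * C * measure M (space M - A m)) \<longlonglongrightarrow> 0"
      by (rule tendsto_mult_right_zero[OF A_lim])
    then have "\<forall>\<^sub>F m in sequentially. 2 * C * measure M (space M - A m) < r / 2"
      by (rule order_tendstoD(2)) (use \<open>0 < r\<close> in simp)
    \<comment> \<open>The level \<open>m\<close> is fixed before \<open>N\<close> tends to infinity;
      the constant \<open>K (real m)\<close> may be large but does not depend on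
      \<open>N\<close>.\<close>
    then obtain m where m: "2 * C * measure M (space M - A m) < r / 2"
      by (auto simp: eventually_sequentially)
    have "(\<lambda>N. 2 * K (real m) * (real N * (T / real N) powr (2 * H))) \<longlonglongrightarrow> 0"
      by (rule tendsto_mult_right_zero[OF mesh_variance_tendsto_0[OF assms(2,8)]])
    then have "\<forall>\<^sub>F N in sequentially. 2 * K (real m) * (real N * (T / real N) powr (2 * H)) < r / 2"
      by (rule order_tendstoD(2)) (use \<open>0 < r\<close> in simp)
    then show "\<forall>\<^sub>F N in sequentially. dist (?E N) 0 < r"
      using eventually_gt_at_top[of 0]
    proof eventually_elim
      case (elim N)
      have "0 \<le> ?E N" by (rule Bochner_Integration.integral_nonneg) simp
      with bound[OF elim(2), of m] elim(1) m show ?case by (simp add: dist_real_def)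
    qed
  qed
qed

end
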